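(* Let $(X,T,\mathcal{A},\mu)$ be a conservative ergodic measure preserving dynamical system, where $\mu$ is an infinite $\sigma$-finite measure. Let $A\in\mathcal{A}$ with $0<\mu(A)<\infty$ be uniformly returning for some $f\in\mathcal{P}_\mu$, with $(b_n)$ a positive increasing sequence diverging to $\infty$ such that $b_n\hat T^n(f)\to1$ $\mu$-a.e. uniformly on $A$, and let $(W_n)=(W_n(A))$ be the wandering rate of $A$. Let $\beta\in[0,1)$. Then $(b_n)$ is regularly varying with exponent $\beta$ if and only if $(W_n)$ is regularly varying with exponent $\beta$. In this case, $$b_n\sim W_n\,\Gamma(1-\beta)\,\Gamma(1+\beta)\qquad(n\to\infty).$$
   Context: $\mathcal{P}_\mu$ denotes the set of probability measures $\nu$ on $\mathcal{A}$ with $\nu\ll\mu$; the same symbol is used for the set of the corresponding densities $d\nu/d\mu$. The transfer operator $\hat T:L_1(\mu)\to L_1(\mu)$ is the positive linear operator characterized by $\int_B\hat T(f)\,d\mu=\int_{T^{-1}(B)}f\,d\mu$ for all $f\in L_1(\mu)$, $B\in\mathcal{A}$. A set $A\in\mathcal{A}$ with $0<\mu(A)<\infty$ is uniformly returning for $f\in\mathcal{P}_\mu$ if there is a positive increasing sequence $(b_n)$ diverging to $\infty$ such that $b_n\hat T^n(f)\to1$ $\mu$-a.e. uniformly on $A$ (i.e. in $L_\infty$-norm on $A$). The wandering rate of $A$ is $W_n=W_n(A):=\mu\left(\bigcup_{k=0}^nT^{-k}A\right)$, $n\ge0$. A measurable function $R:\mathbb{R}^+\to\mathbb{R}$ with $R>0$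 on $(a,\infty)$ for some $a>0$ is regularly varying (at $\infty$) with exponent $\rho\in\mathbb{R}$ if $\lim_{t\to\infty}R(\lambda t)/R(t)=\lambda^\rho$ for all $\lambda>0$. A sequence $(u_n)$ is regularly varying with exponent $\rho$ if $u_n=R(n)$, $n\ge1$, for some function $R$ regularly varying with exponent $\rho$. $c_n\sim a_n$ means $a_n\neq0$ for all but finitely many $n$ and $c_n/a_n\to1$. $\Gamma$ is the Gamma function. *)

theory Defs
  imports "HOL-Probability.Probability" "HOL-Library.Landau_Symbols"
begin

definition measure_preserving :: "'a measure \<Rightarrow> ('a \<Rightarrow> 'a) \<Rightarrow> bool" where
  "measure_preserving M T \<longleftrightarrow>
     T \<in> measurable M M \<and>
     (\<forall>B\<in>sets M. emeasure M (T -` B \<inter> space M) = emeasure M B)"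

definition wandering_set :: "'a measure \<Rightarrow> ('a \<Rightarrow> 'a) \<Rightarrow> 'a set \<Rightarrow> bool" where
  "wandering_set M T B \<longleftrightarrow>
     B \<in> sets M \<and> disjoint_family (\<lambda>n::nat. (T ^^ n) -` B \<inter> space M)"

definition conservative_map :: "'a measure \<Rightarrow> ('a \<Rightarrow> 'a) \<Rightarrow> bool" where
  "conservative_map M T \<longleftrightarrow> (\<forall>B. wandering_set M T B \<longrightarrow> emeasure M B = 0)"

definition ergodic_map :: "'a measure \<Rightarrow> ('a \<Rightarrow> 'a) \<Rightarrow> bool" where
  "ergodic_map M T \<longleftrightarrow>
     (\<forall>B\<in>sets M. T -` B \<inter> space M = B \<longrightarrow> emeasure M B = 0 \<or> emeasure M (space M - B) = 0)"

definition ac_prob_measures :: "'a measure \<Rightarrow> 'a measure set" where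
  "ac_prob_measures M = {N. prob_space N \<and> sets N = sets M \<and> absolutely_continuous M N}"

text \<open>The real-valued versions of the densities of the members of
  \<^term>\<open>ac_prob_measures M\<close> with respect to \<^term>\<open>M\<close>.\<close>
definition ac_prob_densities :: "'a measure \<Rightarrow> ('a \<Rightarrow> real) set" where
  "ac_prob_densities M =
     {f \<in> borel_measurable M. (AE x in M. 0 \<le> f x) \<and>
        density M (\<lambda>x. ennreal (f x)) \<in> ac_prob_measures M}"

definition is_transfer :: "'a measure \<Rightarrow> ('a \<Rightarrow> 'a) \<Rightarrow> ('a \<Rightarrow> real) \<Rightarrow> ('a \<Rightarrow> real) \<Rightarrow> bool" where
  "is_transfer M T f g \<longleftrightarrow>
     integrable M g \<and>
     (\<forall>B\<in>sets M. (LINT x:B|M. g x) = (LINT x:(T -` B \<inter> space M)|M. f x))"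

text \<open>Elements of $L_1$ are represented by integrable functions, so the image of a function
  under the transfer operator is determined only almost everywhere and a version is chosen.
  Existence and uniqueness are the lemmas below.\<close>
definition transfer_op :: "'a measure \<Rightarrow> ('a \<Rightarrow> 'a) \<Rightarrow> ('a \<Rightarrow> real) \<Rightarrow> ('a \<Rightarrow> real)" where
  "transfer_op M T f = (SOME g. is_transfer M T f g)"

lemma is_transfer_unique:
  assumes "is_transfer M T f g" "is_transfer M T f h"
  shows "AE x in M. g x = h x"
  using assms by (intro density_unique_real) (auto simp: is_transfer_def)

lemma is_transfer_nonneg_exists:
  fixes f :: "'a \<Rightarrow> real"
  assumes "sigma_finite_measure M" "measure_preserving M T" "integrable M f" "\<And>x. 0 \<le> f x"
  shows "\<exists>g. is_transfer M T f g"
proof -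
  interpret sigma_finite_measure M by fact
  have T [measurable]: "T \<in> measurable M M"
    and pres: "\<And>B. B \<in> sets M \<Longrightarrow> emeasure M (T -` B \<inter> space M) = emeasure M B"
    using assms(2) by (auto simp: measure_preserving_def)
  have f [measurable]: "f \<in> borel_measurable M" using assms(3) by auto
  define N where "N = distr (density M (\<lambda>x. ennreal (f x))) M T"
  have sN: "sets N = sets M" by (simp add: N_def)
  have emN: "emeasure N B = ennreal (LINT x:(T -` B \<inter> space M)|M. f x)" if B: "B \<in> sets M" for B
  proof -
    have TB: "T -` B \<inter> space M \<in> sets M" using B by measurable
    have "emeasure N B = (\<integral>\<^sup>+x. ennreal (f x) * indicator (T -` B \<inter> space M) x \<partial>M)"
      using B TB by (simp add: N_def emeasure_distr emeasure_density)
    also have "\<dots> = (\<integral>\<^sup>+x. ennreal (indicator (T -` B \<inter> space M) x *\<^sub>R f x) \<partial>M)"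
      by (intro nn_integral_cong) (auto simp: indicator_def)
    also have "\<dots> = ennreal (LINT x:(T -` B \<inter> space M)|M. f x)"
      unfolding set_lebesgue_integral_def
      by (rule nn_integral_eq_integral)
         (use integrable_mult_indicator[OF TB assms(3)] assms(4) in auto)
    finally show ?thesis .
  qed
  have fin: "finite_measure N"
    by (rule finite_measureI) (use emN[of "space M"] in \<open>simp add: N_def\<close>)
  have ac: "absolutely_continuous M N"
    unfolding absolutely_continuous_def
  proof
    fix B assume B: "B \<in> null_sets M"
    have BM: "B \<in> sets M" using B by auto
    have "T -` B \<inter> space M \<in> null_sets M"
      using B BM pres[OF BM] by (intro null_setsI) (auto simp: null_sets_def)
    then have "AE x in M. indicator (T -` B \<inter> space M) x *\<^sub>R f x = 0"
      using AE_not_in by (fastforce elim: AE_mp)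
    then have "(LINT x:(T -` B \<inter> space M)|M. f x) = 0"
      unfolding set_lebesgue_integral_def by (rule integral_eq_zero_AE)
    then have "emeasure N B = 0" using emN[OF BM] by simp
    then show "B \<in> null_sets N" using BM sN by auto
  qed
  obtain D where D: "D \<in> borel_measurable M" "AE x in M. RN_deriv M N x = ennreal (D x)" "\<And>x. 0 \<le> D x"
    using real_RN_deriv[OF fin ac sN] by metis
  have dens: "density M (\<lambda>x. ennreal (D x)) = N"
    using density_RN_deriv[OF ac sN] density_cong[OF _ _ D(2)] D(1) by simp
  have intD: "(\<integral>\<^sup>+x. ennreal (indicator B x *\<^sub>R D x) \<partial>M) = emeasure N B" if "B \<in> sets M" for B
  proof -
    have "emeasure N B = (\<integral>\<^sup>+x. ennreal (D x) * indicator B x \<partial>M)"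
      using that D(1) by (simp add: dens[symmetric] emeasure_density)
    also have "\<dots> = (\<integral>\<^sup>+x. ennreal (indicator B x *\<^sub>R D x) \<partial>M)"
      by (intro nn_integral_cong) (auto simp: indicator_def)
    finally show ?thesis ..
  qed
  have "(\<integral>\<^sup>+x. ennreal (D x) \<partial>M) = emeasure N (space M)"
    using intD[of "space M"] by (auto cong: nn_integral_cong simp: indicator_def)
  then have iD: "integrable M D"
    using D emN[of "space M"] by (intro integrableI_nonneg) auto
  have "(LINT x:B|M. D x) = (LINT x:(T -` B \<inter> space M)|M. f x)" if "B \<in> sets M" for B
  proof -
    have "(\<integral>\<^sup>+x. ennreal (indicator B x *\<^sub>R D x) \<partial>M) = ennreal (LINT x:B|M. D x)"
      unfolding set_lebesgue_integral_def
      by (rule nn_integral_eq_integral) (use integrable_mult_indicator[OF that iD] D(3) in auto)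
    moreover have "0 \<le> (LINT x:B|M. D x)" "0 \<le> (LINT x:(T -` B \<inter> space M)|M. f x)"
      unfolding set_lebesgue_integral_def using D assms by (auto intro!: integral_nonneg_AE)
    ultimately show ?thesis using intD[OF that] emN[OF that] by simp
  qed
  then show ?thesis using iD by (auto simp: is_transfer_def)
qed

lemma is_transfer_exists:
  fixes f :: "'a \<Rightarrow> real"
  assumes "sigma_finite_measure M" "measure_preserving M T" "integrable M f"
  shows "\<exists>g. is_transfer M T f g"
proof -
  have ip: "integrable M (\<lambda>x. max 0 (f x))" "integrable M (\<lambda>x. max 0 (- f x))"
    using assms(3) by auto
  obtain g h where g: "is_transfer M T (\<lambda>x. max 0 (f x)) g"
    and h: "is_transfer M T (\<lambda>x. max 0 (- f x)) h"
    using is_transfer_nonneg_exists[OF assms(1,2) ip(1)]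
      is_transfer_nonneg_exists[OF assms(1,2) ip(2)] by auto
  have "is_transfer M T f (\<lambda>x. g x - h x)"
    unfolding is_transfer_def
  proof (intro conjI ballI)
    show "integrable M (\<lambda>x. g x - h x)" using g h by (auto simp: is_transfer_def)
    fix B assume B: "B \<in> sets M"
    have TB: "T -` B \<inter> space M \<in> sets M"
      using B assms(2) by (auto simp: measure_preserving_def)
    have si: "set_integrable M C k" if "C \<in> sets M" "integrable M k" for C and k :: "'a \<Rightarrow> real"
      using that unfolding set_integrable_def by (rule integrable_mult_indicator)
    have "(LINT x:B|M. g x - h x) = (LINT x:B|M. g x) - (LINT x:B|M. h x)"
      using g h B by (intro set_integral_diff si) (auto simp: is_transfer_def)
    also have "\<dots> = (LINT x:(T -` B \<inter> space M)|M. max 0 (f x))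
        - (LINT x:(T -` B \<inter> space M)|M. max 0 (- f x))"
      using g h B by (simp add: is_transfer_def)
    also have "\<dots> = (LINT x:(T -` B \<inter> space M)|M. max 0 (f x) - max 0 (- f x))"
      using TB ip by (intro set_integral_diff(2)[symmetric] si) auto
    also have "(\<lambda>x. max 0 (f x) - max 0 (- f x)) = f" by (auto simp: max_def)
    finally show "(LINT x:B|M. g x - h x) = (LINT x:(T -` B \<inter> space M)|M. f x)" by simp
  qed
  then show ?thesis by blast
qed

lemma is_transfer_transfer_op:
  assumes "sigma_finite_measure M" "measure_preserving M T" "integrable M f"
  shows "is_transfer M T f (transfer_op M T f)"
  unfolding transfer_op_def using is_transfer_exists[OF assms] by (rule someI_ex)

text \<open>The set $A$ is uniformly returning for $f$, with the sequence $b$ as witness. ``Increasing''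
  is understood in the weak sense; the convergence is in the $L_\infty$-norm on $A$.\<close>
definition uniformly_returning_via ::
    "'a measure \<Rightarrow> ('a \<Rightarrow> 'a) \<Rightarrow> 'a set \<Rightarrow> ('a \<Rightarrow> real) \<Rightarrow> (nat \<Rightarrow> real) \<Rightarrow> bool" where
  "uniformly_returning_via M T A f b \<longleftrightarrow>
     A \<in> sets M \<and> 0 < emeasure M A \<and> emeasure M A < \<infinity> \<and>
     f \<in> ac_prob_densities M \<and>
     (\<forall>n. 0 < b n) \<and> incseq b \<and> filterlim b at_top sequentially \<and>
     (\<lambda>n. esssup (restrict_space M A) (\<lambda>x. ereal \<bar>b n * (transfer_op M T ^^ n) f x - 1\<bar>))
        \<longlonglongrightarrow> 0"

definition wandering_rate :: "'a measure \<Rightarrow> ('a \<Rightarrow> 'a) \<Rightarrow> 'a set \<Rightarrow> nat \<Rightarrow> real" where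
  "wandering_rate M T A n = measure M (\<Union>k\<le>n. (T ^^ k) -` A \<inter> space M)"

text \<open>Only the values of $R$ on the positive half-line matter.\<close>
definition regularly_varying :: "(real \<Rightarrow> real) \<Rightarrow> real \<Rightarrow> bool" where
  "regularly_varying R \<rho> \<longleftrightarrow>
     R \<in> borel_measurable (restrict_space borel {0<..}) \<and>
     (\<exists>a>0. \<forall>t>a. R t > 0) \<and>
     (\<forall>c>0. ((\<lambda>t. R (c * t) / R t) \<longlongrightarrow> c powr \<rho>) at_top)"

definition regularly_varying_seq :: "(nat \<Rightarrow> real) \<Rightarrow> real \<Rightarrow> bool" where
  "regularly_varying_seq u \<rho> \<longleftrightarrow>
     (\<exists>R. regularly_varying R \<rho> \<and> (\<forall>n\<ge>1. u n = R (real n)))"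

end

theory Submission
  imports Defs
begin

text \<open>Sorting the points that visit \<open>A\<close> up to time \<open>n\<close> by the time of their last visit gives, with
  \<open>q j\<close> the measure of the set of points of \<open>A\<close> that do not return to \<open>A\<close> within \<open>j\<close> steps,
  \<open>W n = (\<Sum>j\<le>n. q j)\<close>; integrating the density \<open>f\<close> over the same partition and using uniform return
  gives the renewal relation \<open>(\<Sum>k\<le>n. q (n - k) / b k) \<longlonglongrightarrow> 1\<close>. Hence the Laplace transforms of
  the step functions of \<open>W\<close> and of \<open>1 / b\<close> have a product asymptotic to \<open>1 / s\<^sup>2\<close> as \<open>s\<close> tends to
  \<open>0\<close>, and since both sequences are monotone, an Abelian theorem for one and Karamata's Tauberian
  theorem for the other transfer regular variation and the asymptotics.\<close>

section \<open>Laplace transforms of monotone functions\<close>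

text \<open>Uniform return controls the iterates of \<open>f\<close> only on \<open>A\<close>,
  whereas \<open>W\<close> and the mass of \<open>f\<close> concern preimages of \<open>A\<close>
  spread over the space. Sorting by the last visit reconciles the two: every piece is the preimage
  under some \<open>T ^^ k\<close> of a subset of \<open>A\<close>, so invariance of the measure and
  duality of the transfer operator both bring it back into \<open>A\<close>. The error left by
  uniform return is then at most a small multiple of \<open>q j\<close>, whatever \<open>j\<close>
  is, and an error of this relative kind survives the convolution. One factor \<open>1 / s\<close>
  of the product comes from the limit 1 of the convolution, the other from passing from
  \<open>q\<close> to its partial sums \<open>W\<close>. A Laplace transform only yields averages;
  monotonicity turns them into values. The exponents of the two sequences are \<beta> and -\<beta>,
  so \<beta> < 1 keeps the limit profile \<open>x powr - \<beta>\<close> integrable at 0. The Gamma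
  factors are the transforms at 1 of \<open>x powr \<beta>\<close> and
  \<open>x powr - \<beta>\<close>.\<close>

abbreviation pos_lborel :: "real measure" where
  "pos_lborel \<equiv> restrict_space lborel {0<..}"

lemma space_pos_lborel: "x \<in> space pos_lborel \<longleftrightarrow> 0 < x"
  by (simp add: space_restrict_space)

lemma measurable_pos_lborel:
  "f \<in> borel_measurable borel \<Longrightarrow> f \<in> borel_measurable pos_lborel"
  by (rule measurable_restrict_space1) simp

section \<open>Scaling and the Gamma integral on the half-line\<close>

lemma pos_lborel_scale:
  fixes f :: "real \<Rightarrow> real"
  assumes "0 < c"
  shows "integrable pos_lborel (\<lambda>x. f (c * x)) \<longleftrightarrow> integrable pos_lborel f"
    and "integral\<^sup>L pos_lborel (\<lambda>x. f (c * x)) = integral\<^sup>L pos_lborel f / c"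
proof -
  have ind: "indicator {0<..} (c * x) = (indicator {0<..} x :: real)" for x
    using assms by (auto simp: indicator_def zero_less_mult_iff)
  show "integrable pos_lborel (\<lambda>x. f (c * x)) \<longleftrightarrow> integrable pos_lborel f"
    using lborel_integrable_real_affine_iff[of c "\<lambda>x. indicator {0<..} x * f x" 0] assms
    by (simp add: integrable_restrict_space ind)
  show "integral\<^sup>L pos_lborel (\<lambda>x. f (c * x)) = integral\<^sup>L pos_lborel f / c"
    using lborel_integral_real_affine[of c "\<lambda>x. indicator {0<..} x * f x" 0] assms
    by (simp add: integral_restrict_space ind)
qed

lemma laplace_powr:
  assumes "- 1 < a" "0 < l"
  shows "integrable pos_lborel (\<lambda>x. exp (- (l * x)) * x powr a)"
    and "(\<integral>x. exp (- (l * x)) * x powr a \<partial>pos_lborel) = Gamma (1 + a) * l powr (- 1 - a)"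
proof -
  have "has_bochner_integral pos_lborel (\<lambda>x. exp (- x) * x powr a) (Gamma (1 + a))"
  proof (rule has_bochner_integral_nn_integral)
    show "0 \<le> Gamma (1 + a)" using assms by (intro Gamma_real_nonneg) auto
    have "(\<integral>\<^sup>+x. ennreal (exp (- x) * x powr a) \<partial>pos_lborel) =
      (\<integral>\<^sup>+x. ennreal (exp (- x) * x powr a) * indicator {0<..} x \<partial>lborel)"
      by (simp add: nn_integral_restrict_space)
    also have "\<dots> = (\<integral>\<^sup>+t. ennreal (indicator {0..} t * t powr (1 + a - 1) / exp t) \<partial>lborel)"
      by (intro nn_integral_cong) (auto simp: indicator_def exp_minus field_simps)
    finally show "(\<integral>\<^sup>+x. ennreal (exp (- x) * x powr a) \<partial>pos_lborel) = ennreal (Gamma (1 + a))"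
      using Gamma_conv_nn_integral_real[of "1 + a"] assms by simp
  qed (auto intro!: measurable_pos_lborel)
  then have *: "integrable pos_lborel (\<lambda>x. exp (- x) * x powr a)"
    "(\<integral>x. exp (- x) * x powr a \<partial>pos_lborel) = Gamma (1 + a)"
    by (auto simp: has_bochner_integral_iff)
  have eq: "exp (- (l * x)) * x powr a = l powr (- a) * (exp (- (l * x)) * (l * x) powr a)"
    if "x \<in> space pos_lborel" for x
    using assms that by (auto simp: powr_mult powr_minus space_restrict_space)
  have i: "integrable pos_lborel (\<lambda>x. exp (- (l * x)) * (l * x) powr a)"
    "(\<integral>x. exp (- (l * x)) * (l * x) powr a \<partial>pos_lborel) = Gamma (1 + a) / l"
    using pos_lborel_scale[OF \<open>0 < l\<close>, of "\<lambda>x. exp (- x) * x powr a"] * by auto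
  show "integrable pos_lborel (\<lambda>x. exp (- (l * x)) * x powr a)"
    using integrable_mult_right[OF i(1), of "l powr (- a)"] eq
    by (subst Bochner_Integration.integrable_cong[OF refl eq]) auto
  show "(\<integral>x. exp (- (l * x)) * x powr a \<partial>pos_lborel) = Gamma (1 + a) * l powr (- 1 - a)"
    using i assms
    by (subst Bochner_Integration.integral_cong[OF refl eq])
      (auto simp: powr_diff powr_minus field_simps)
qed

text \<open>Under \<open>y = exp (- x)\<close> the half-line becomes (0, 1), exponential sums become
  polynomials without constant term, and the Weierstrass theorem applies to
  \<open>g x / exp (- x)\<close>. Multiplying back leaves the weight \<open>exp (- x)\<close> on the
  error, which keeps it integrable against any function with a finite transform at 1.\<close>

lemma compact_support_exp_approx:
  fixes g :: "real \<Rightarrow> real"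
  assumes g: "continuous_on UNIV g" and b: "\<And>x. b \<le> x \<Longrightarrow> g x = 0" and e: "0 < e"
  shows "\<exists>c n. \<forall>x>0. \<bar>g x - (\<Sum>i\<le>n. c i * exp (- (real (Suc i) * x)))\<bar> \<le> e * exp (- x)"
proof -
  define \<delta> where "\<delta> = exp (- b)"
  \<comment> \<open>For \<open>y\<close> below \<delta> the argument \<open>- ln y\<close> exceeds
    \<open>b\<close>, where \<open>g\<close> vanishes. Freezing \<open>y\<close> at \<delta>
    therefore changes no value and removes the singularities of \<open>ln\<close> and of the
    quotient at 0.\<close>
  define \<phi> where "\<phi> y = g (- ln (max y \<delta>)) / max y \<delta>" for y
  have \<delta>: "0 < \<delta>" by (simp add: \<delta>_def)
  have "continuous_on {0..1} \<phi>"
    unfolding \<phi>_def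
    using \<delta> by (intro continuous_intros continuous_on_compose2[OF g]) (simp_all add: max_def not_le)
  from Stone_Weierstrass_real_polynomial_function[OF compact_Icc this e]
  obtain p where p: "real_polynomial_function p" "\<And>y. y \<in> {0..1} \<Longrightarrow> \<bar>\<phi> y - p y\<bar> < e"
    by blast
  obtain c n where cn: "p = (\<lambda>y. \<Sum>i\<le>n. c i * y ^ i)"
    using p(1) unfolding real_polynomial_function_iff_sum by blast
  have "\<bar>g x - (\<Sum>i\<le>n. c i * exp (- (real (Suc i) * x)))\<bar> \<le> e * exp (- x)" if x: "0 < x" for x
  proof -
    have "g x = \<phi> (exp (- x)) * exp (- x)"
    proof (cases "x \<le> b")
      case True
      then have "max (exp (- x)) \<delta> = exp (- x)" by (simp add: \<delta>_def max_def)
      then show ?thesis by (simp add: \<phi>_def)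
    next
      case False
      then have "max (exp (- x)) \<delta> = \<delta>" by (simp add: \<delta>_def max_def)
      then show ?thesis using b[of x] b[of b] False by (simp add: \<phi>_def \<delta>_def)
    qed
    moreover have "exp (- (real (Suc i) * x)) = exp (- x) ^ i * exp (- x)" for i
      using exp_of_nat_mult[of "Suc i" "- x"] by (simp only: mult_minus_right power_Suc2)
    then have "(\<Sum>i\<le>n. c i * exp (- (real (Suc i) * x))) = p (exp (- x)) * exp (- x)"
      unfolding cn sum_distrib_right by (intro sum.cong refl) (simp only: mult.assoc)
    ultimately have "g x - (\<Sum>i\<le>n. c i * exp (- (real (Suc i) * x)))
        = (\<phi> (exp (- x)) - p (exp (- x))) * exp (- x)"
      by (simp add: algebra_simps)
    moreover have "\<bar>\<phi> (exp (- x)) - p (exp (- x))\<bar> \<le> e"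
      using x by (intro less_imp_le p(2)) simp
    ultimately show ?thesis by (simp only: abs_mult abs_exp_cancel mult_right_mono exp_ge_zero)
  qed
  then show ?thesis by blast
qed

text \<open>Split \<open>g\<close> into an exponential sum and a remainder bounded by
  \<open>exp (- x)\<close>. Both parts times \<open>h\<close> are integrable by the hypothesis on
  the transforms.\<close>

lemma compact_support_integrable:
  fixes g h :: "real \<Rightarrow> real"
  assumes g: "continuous_on UNIV g" and b: "\<And>x. b \<le> x \<Longrightarrow> g x = 0"
    and m: "h \<in> borel_measurable pos_lborel"
    and i: "\<And>n. integrable pos_lborel (\<lambda>x. exp (- (real (Suc n) * x)) * h x)"
  shows "integrable pos_lborel (\<lambda>x. g x * h x)"
proof -
  obtain c n where cn: "\<And>x. 0 < x \<Longrightarrow>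
      \<bar>g x - (\<Sum>i\<le>n. c i * exp (- (real (Suc i) * x)))\<bar> \<le> 1 * exp (- x)"
    using compact_support_exp_approx[OF g b zero_less_one] by blast
  have mg: "g \<in> borel_measurable pos_lborel"
    using g by (intro measurable_pos_lborel borel_measurable_continuous_onI)
  have "(\<lambda>x. \<Sum>i\<le>n. c i * exp (- (real (Suc i) * x))) \<in> borel_measurable pos_lborel"
    by (rule measurable_pos_lborel) measurable
  note ms = borel_measurable_times[OF borel_measurable_diff[OF mg this] m]
  have "integrable pos_lborel (\<lambda>x. (\<Sum>i\<le>n. c i * (exp (- (real (Suc i) * x)) * h x)))"
    by (intro Bochner_Integration.integrable_sum integrable_mult_right i)
  moreover have "integrable pos_lborel
      (\<lambda>x. (g x - (\<Sum>i\<le>n. c i * exp (- (real (Suc i) * x)))) * h x)"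
  proof (rule Bochner_Integration.integrable_bound[OF i[of 0]])
    show "AE x in pos_lborel. norm ((g x - (\<Sum>i\<le>n. c i * exp (- (real (Suc i) * x)))) * h x)
        \<le> norm (exp (- (real (Suc 0) * x)) * h x)"
    proof (rule AE_I2)
      fix x :: real assume "x \<in> space pos_lborel"
      then have "\<bar>g x - (\<Sum>i\<le>n. c i * exp (- (real (Suc i) * x)))\<bar> \<le> exp (- (real (Suc 0) * x))"
        using cn[of x] by (simp only: space_pos_lborel One_nat_def[symmetric] of_nat_1 mult_1_left)
      then show "norm ((g x - (\<Sum>i\<le>n. c i * exp (- (real (Suc i) * x)))) * h x)
          \<le> norm (exp (- (real (Suc 0) * x)) * h x)"
        unfolding real_norm_def abs_mult abs_exp_cancel by (rule mult_right_mono) simp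
    qed
  qed (rule ms)
  ultimately have "integrable pos_lborel
      (\<lambda>x. (\<Sum>i\<le>n. c i * (exp (- (real (Suc i) * x)) * h x))
        + (g x - (\<Sum>i\<le>n. c i * exp (- (real (Suc i) * x)))) * h x)"
    by (rule Bochner_Integration.integrable_add)
  moreover have "(\<Sum>i\<le>n. c i * (exp (- (real (Suc i) * x)) * h x))
      + (g x - (\<Sum>i\<le>n. c i * exp (- (real (Suc i) * x)))) * h x = g x * h x" for x
    unfolding left_diff_distrib sum_distrib_right mult.assoc by simp
  ultimately show ?thesis by (simp only:)
qed

text \<open>Transforms at the positive integers suffice. Against any nonnegative \<open>h\<close>
  the integral of \<open>g\<close> differs from a fixed linear combination of such transforms by at
  most \<open>e\<close> times the transform of \<open>h\<close> at 1, and that factor stays bounded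
  along the filter.\<close>

lemma laplace_tendsto_test_function:
  fixes H :: "'i \<Rightarrow> real \<Rightarrow> real" and G g :: "real \<Rightarrow> real"
  assumes g: "continuous_on UNIV g" and b: "\<And>x. b \<le> x \<Longrightarrow> g x = 0"
    and mH: "\<And>t. H t \<in> borel_measurable pos_lborel" and mG: "G \<in> borel_measurable pos_lborel"
    and H0: "\<And>t x. 0 < x \<Longrightarrow> 0 \<le> H t x" and G0: "\<And>x. 0 < x \<Longrightarrow> 0 \<le> G x"
    and iH: "\<And>t n. integrable pos_lborel (\<lambda>x. exp (- (real (Suc n) * x)) * H t x)"
    and iG: "\<And>n. integrable pos_lborel (\<lambda>x. exp (- (real (Suc n) * x)) * G x)"
    and lim: "\<And>n. ((\<lambda>t. \<integral>x. exp (- (real (Suc n) * x)) * H t x \<partial>pos_lborel) \<longlongrightarrow>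
        (\<integral>x. exp (- (real (Suc n) * x)) * G x \<partial>pos_lborel)) F"
  shows "((\<lambda>t. \<integral>x. g x * H t x \<partial>pos_lborel) \<longlongrightarrow> (\<integral>x. g x * G x \<partial>pos_lborel)) F"
proof (rule tendstoI)
  fix \<epsilon> :: real assume \<epsilon>: "0 < \<epsilon>"
  define L where "L h n = (\<integral>x. exp (- (real (Suc n) * x)) * h x \<partial>pos_lborel)" for h and n :: nat
  have L0: "0 \<le> L G 0"
    unfolding L_def by (intro integral_nonneg_AE AE_I2) (auto simp: space_restrict_space G0)
  \<comment> \<open>The error occurs once for \<open>H t\<close> and once for \<open>G\<close>, in
    the limit \<open>2 * e * L G 0\<close> in total. This choice makes it less than \<epsilon>; the
    summand 1 keeps the denominator positive when \<open>L G 0\<close> is 0.\<close>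
  define e where "e = \<epsilon> / (2 * (2 * L G 0 + 1))"
  have e: "0 < e" using \<epsilon> L0 by (auto simp: e_def)
  obtain c n where cn: "\<And>x. 0 < x \<Longrightarrow>
      \<bar>g x - (\<Sum>i\<le>n. c i * exp (- (real (Suc i) * x)))\<bar> \<le> e * exp (- x)"
    using compact_support_exp_approx[OF g b e] by blast
  have approx: "\<bar>(\<integral>x. g x * h x \<partial>pos_lborel) - (\<Sum>i\<le>n. c i * L h i)\<bar> \<le> e * L h 0"
    if mh: "h \<in> borel_measurable pos_lborel" and h0: "\<And>x. 0 < x \<Longrightarrow> 0 \<le> h x"
      and ih: "\<And>n. integrable pos_lborel (\<lambda>x. exp (- (real (Suc n) * x)) * h x)" for h
  proof -
    have i1: "integrable pos_lborel (\<lambda>x. g x * h x)"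
      by (rule compact_support_integrable[OF g b mh ih])
    have i2: "integrable pos_lborel (\<lambda>x. \<Sum>i\<le>n. c i * (exp (- (real (Suc i) * x)) * h x))"
      by (intro Bochner_Integration.integrable_sum integrable_mult_right ih)
    have "(\<Sum>i\<le>n. c i * L h i) = (\<integral>x. (\<Sum>i\<le>n. c i * (exp (- (real (Suc i) * x)) * h x)) \<partial>pos_lborel)"
      using ih by (subst Bochner_Integration.integral_sum)
        (auto intro!: Bochner_Integration.integrable_mult_right simp: L_def simp del: of_nat_Suc)
    then have "\<bar>(\<integral>x. g x * h x \<partial>pos_lborel) - (\<Sum>i\<le>n. c i * L h i)\<bar>
        = \<bar>\<integral>x. g x * h x - (\<Sum>i\<le>n. c i * (exp (- (real (Suc i) * x)) * h x)) \<partial>pos_lborel\<bar>"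
      using i1 i2 by simp
    also have "\<dots> \<le> (\<integral>x. \<bar>g x * h x - (\<Sum>i\<le>n. c i * (exp (- (real (Suc i) * x)) * h x))\<bar> \<partial>pos_lborel)"
      by (rule integral_abs_bound)
    also have "\<dots> \<le> (\<integral>x. e * (exp (- (real (Suc 0) * x)) * h x) \<partial>pos_lborel)"
    proof (rule integral_mono)
      fix x assume "x \<in> space pos_lborel"
      then have x: "0 < x" by (simp add: space_restrict_space)
      have "g x * h x - (\<Sum>i\<le>n. c i * (exp (- (real (Suc i) * x)) * h x))
          = (g x - (\<Sum>i\<le>n. c i * exp (- (real (Suc i) * x)))) * h x"
        by (simp add: left_diff_distrib sum_distrib_right mult.assoc)
      then have "\<bar>g x * h x - (\<Sum>i\<le>n. c i * (exp (- (real (Suc i) * x)) * h x))\<bar>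
          = \<bar>g x - (\<Sum>i\<le>n. c i * exp (- (real (Suc i) * x)))\<bar> * h x"
        using h0[OF x] by (simp only: abs_mult abs_of_nonneg)
      also have "\<dots> \<le> (e * exp (- x)) * h x"
        using cn[OF x] h0[OF x] by (rule mult_right_mono)
      finally show "\<bar>g x * h x - (\<Sum>i\<le>n. c i * (exp (- (real (Suc i) * x)) * h x))\<bar>
          \<le> e * (exp (- (real (Suc 0) * x)) * h x)" by (simp add: mult.assoc)
    qed (use i1 i2 ih[of 0] in auto)
    also have "\<dots> = e * L h 0" by (simp add: L_def)
    finally show ?thesis .
  qed
  have "((\<lambda>t. \<bar>(\<Sum>i\<le>n. c i * L (H t) i) - (\<Sum>i\<le>n. c i * L G i)\<bar> + e * L (H t) 0)
      \<longlongrightarrow> \<bar>(\<Sum>i\<le>n. c i * L G i) - (\<Sum>i\<le>n. c i * L G i)\<bar> + e * L G 0) F"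
    using lim by (intro tendsto_intros) (auto simp: L_def simp del: of_nat_Suc)
  moreover have "\<bar>(\<Sum>i\<le>n. c i * L G i) - (\<Sum>i\<le>n. c i * L G i)\<bar> + e * L G 0 < \<epsilon> - e * L G 0"
  proof -
    have "e * (2 * L G 0 + 1) = \<epsilon> / 2" using L0 by (simp add: e_def field_simps)
    then show ?thesis using e \<epsilon> by (simp add: algebra_simps)
  qed
  ultimately have "\<forall>\<^sub>F t in F. \<bar>(\<Sum>i\<le>n. c i * L (H t) i) - (\<Sum>i\<le>n. c i * L G i)\<bar> + e * L (H t) 0
      < \<epsilon> - e * L G 0"
    by (rule order_tendstoD)
  then show "\<forall>\<^sub>F t in F. dist (\<integral>x. g x * H t x \<partial>pos_lborel) (\<integral>x. g x * G x \<partial>pos_lborel) < \<epsilon>"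
  proof eventually_elim
    case (elim t)
    then show ?case
      using approx[OF mH H0 iH, of t] approx[OF mG G0 iG] unfolding dist_real_def by linarith
  qed
qed

text \<open>The tent over the interval from \<open>a\<close> to \<open>b\<close>: a continuous
  weight that is positive exactly inside it, so that a weighted mean of a monotone function lies
  between the end values.\<close>

definition bump :: "real \<Rightarrow> real \<Rightarrow> real \<Rightarrow> real" where
  "bump a b x = max 0 (min (x - a) (b - x))"

lemma bump_integral:
  assumes "0 < a" "a < b"
  shows "integrable pos_lborel (bump a b)" "0 < integral\<^sup>L pos_lborel (bump a b)"
proof -
  have c: "continuous_on UNIV (bump a b)" unfolding bump_def by (intro continuous_intros)
  have "integrable pos_lborel (\<lambda>x. exp (- (real (Suc n) * x)) * 1)" for n
    using laplace_powr(1)[of 0 "real (Suc n)"]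
    by (rule Bochner_Integration.integrable_cong[OF refl, THEN iffD1, rotated])
      (auto simp: space_restrict_space)
  from compact_support_integrable[OF c _ _ this, of b]
  show i: "integrable pos_lborel (bump a b)" by (simp add: bump_def[abs_def])
  show "0 < integral\<^sup>L pos_lborel (bump a b)"
  proof (rule ccontr)
    assume "\<not> ?thesis"
    moreover have nn: "AE x in pos_lborel. 0 \<le> bump a b x" by (simp add: bump_def)
    ultimately have "integral\<^sup>L pos_lborel (bump a b) = 0"
      using integral_nonneg_AE[OF nn] by linarith
    then have "AE x in pos_lborel. bump a b x = 0"
      using integral_nonneg_eq_0_iff_AE[OF i nn] by simp
    then have "AE x in lborel. x \<notin> {a<..<b}"
      using assms by (auto simp: AE_restrict_space_iff bump_def elim!: eventually_mono split: if_splits)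
    then have "emeasure lborel {a<..<b} = 0"
      by (subst (asm) AE_iff_measurable[of "{a<..<b}"]) auto
    then show False using assms by simp
  qed
qed

text \<open>The sign \<open>\<sigma>\<close> lets the increasing and the decreasing case be treated at once.\<close>

lemma bump_sandwich:
  fixes h :: "real \<Rightarrow> real"
  assumes ab: "0 < a" "a < b" and m: "mono_on {0<..} (\<lambda>x. \<sigma> * h x)"
    and i: "integrable pos_lborel (\<lambda>x. bump a b x * h x)"
  defines "I \<equiv> integral\<^sup>L pos_lborel (bump a b)"
    and "J \<equiv> (\<integral>x. bump a b x * h x \<partial>pos_lborel)"
  shows "\<sigma> * h a \<le> \<sigma> * (J / I)" "\<sigma> * (J / I) \<le> \<sigma> * h b"
proof -
  have I: "0 < I" using bump_integral[OF ab] by (simp add: I_def)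
  have J: "\<sigma> * J = (\<integral>x. bump a b x * (\<sigma> * h x) \<partial>pos_lborel)"
    unfolding J_def by (subst integral_mult_right_zero[symmetric])
      (auto intro!: Bochner_Integration.integral_cong simp: algebra_simps)
  have i': "integrable pos_lborel (\<lambda>x. bump a b x * (\<sigma> * h x))"
    using integrable_mult_right[OF i, of \<sigma>] by (simp add: algebra_simps)
  have eq: "I * (\<sigma> * h y) = (\<integral>x. bump a b x * (\<sigma> * h y) \<partial>pos_lborel)" for y
    by (simp add: I_def)
  have ib: "integrable pos_lborel (\<lambda>x. bump a b x * (\<sigma> * h y))" for y
    using bump_integral[OF ab] by (intro integrable_mult_left) auto
  have z: "bump a b x = 0" if "x \<notin> {a<..<b}" for x using that by (auto simp: bump_def)
  have nn: "0 \<le> bump a b x" for x by (auto simp: bump_def)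
  have "I * (\<sigma> * h a) \<le> \<sigma> * J"
    unfolding J eq
  proof (rule integral_mono[OF ib i'])
    fix x
    show "bump a b x * (\<sigma> * h a) \<le> bump a b x * (\<sigma> * h x)"
      using z[of x] mono_onD[OF m, of a x] ab nn[of x]
      by (cases "x \<in> {a<..<b}") (auto intro!: mult_left_mono)
  qed
  then show "\<sigma> * h a \<le> \<sigma> * (J / I)" using I by (simp add: field_simps)
  have "\<sigma> * J \<le> I * (\<sigma> * h b)"
    unfolding J eq
  proof (rule integral_mono[OF i' ib])
    fix x
    show "bump a b x * (\<sigma> * h x) \<le> bump a b x * (\<sigma> * h b)"
      using z[of x] mono_onD[OF m, of x b] ab nn[of x]
      by (cases "x \<in> {a<..<b}") (auto intro!: mult_left_mono)
  qed
  then show "\<sigma> * (J / I) \<le> \<sigma> * h b" using I by (simp add: field_simps)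
qed

text \<open>The value of \<open>H t\<close> at 1 is bracketed by its tent averages over an interval
  ending at 1 and one starting at 1. These averages converge to those of \<open>G\<close>, and
  continuity of \<open>G\<close> at 1 closes the bracket. The single point 1 is enough because
  scaling can be absorbed into \<open>H\<close>.\<close>

lemma laplace_tendsto_monotone:
  fixes H :: "'i \<Rightarrow> real \<Rightarrow> real" and G :: "real \<Rightarrow> real" and \<sigma> :: real
  assumes \<sigma>: "\<sigma> \<noteq> 0"
    and mH: "\<And>t. H t \<in> borel_measurable pos_lborel" and mG: "G \<in> borel_measurable pos_lborel"
    and H0: "\<And>t x. 0 < x \<Longrightarrow> 0 \<le> H t x" and G0: "\<And>x. 0 < x \<Longrightarrow> 0 \<le> G x"
    and iH: "\<And>t n. integrable pos_lborel (\<lambda>x. exp (- (real (Suc n) * x)) * H t x)"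
    and iG: "\<And>n. integrable pos_lborel (\<lambda>x. exp (- (real (Suc n) * x)) * G x)"
    and lim: "\<And>n. ((\<lambda>t. \<integral>x. exp (- (real (Suc n) * x)) * H t x \<partial>pos_lborel) \<longlongrightarrow>
        (\<integral>x. exp (- (real (Suc n) * x)) * G x \<partial>pos_lborel)) F"
    and monoH: "\<And>t. mono_on {0<..} (\<lambda>x. \<sigma> * H t x)" and monoG: "mono_on {0<..} (\<lambda>x. \<sigma> * G x)"
    and cont: "isCont G 1"
  shows "((\<lambda>t. H t 1) \<longlongrightarrow> G 1) F"
proof -
  define Q where "Q a b h = (\<integral>x. bump a b x * h x \<partial>pos_lborel) / integral\<^sup>L pos_lborel (bump a b)"
    for a b h
  have c: "continuous_on UNIV (bump a b)" for a b unfolding bump_def by (intro continuous_intros)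
  have lim_bump: "((\<lambda>t. \<sigma> * Q a b (H t)) \<longlongrightarrow> \<sigma> * Q a b G) F" if "0 < a" "a < b" for a b
    unfolding Q_def using bump_integral[OF that]
    by (intro tendsto_intros laplace_tendsto_test_function[where b = b, OF c _ mH mG H0 G0 iH iG lim])
      (auto simp: bump_def)
  have ib: "integrable pos_lborel (\<lambda>x. bump a b x * H t x)"
    "integrable pos_lborel (\<lambda>x. bump a b x * G x)" if "0 < a" "a < b" for a b t
    using compact_support_integrable[OF c, of b a b] mH mG iH iG by (auto simp: bump_def)
  note sandG = bump_sandwich[OF _ _ monoG ib(2), folded Q_def]
  note sandH = bump_sandwich[OF _ _ monoH ib(1), folded Q_def]
  have cont': "((\<lambda>x. \<sigma> * G x) \<longlongrightarrow> \<sigma> * G 1) (at 1)"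
    using cont by (intro tendsto_intros) (simp add: isCont_def)
  have "((\<lambda>t. \<sigma> * H t 1) \<longlongrightarrow> \<sigma> * G 1) F"
  proof (rule order_tendstoI)
    fix y assume y: "\<sigma> * G 1 < y"
    have "\<forall>\<^sub>F b in at_right 1. \<sigma> * G b < y \<and> b \<in> {1<..}"
      using tendsto_within_subset[OF cont' subset_UNIV] y
      by (intro eventually_conj order_tendstoD(2) eventually_at_right_less)
        (auto simp: eventually_at_filter)
    then obtain b where b: "1 < b" "\<sigma> * G b < y"
      using eventually_happens'[OF trivial_limit_at_right_real] by (metis (no_types, lifting) greaterThan_iff)
    have "\<sigma> * Q 1 b G < y" using sandG(2)[of 1 b] b by auto
    then have "\<forall>\<^sub>F t in F. \<sigma> * Q 1 b (H t) < y"
      using lim_bump[of 1 b] b(1) by (intro order_tendstoD(2)[of _ "\<sigma> * Q 1 b G"]) auto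
    then show "\<forall>\<^sub>F t in F. \<sigma> * H t 1 < y"
    proof eventually_elim
      case (elim t)
      then show ?case using sandH(1)[of 1 b t] b(1) by auto
    qed
  next
    fix y assume y: "y < \<sigma> * G 1"
    have "\<forall>\<^sub>F a in at_left 1. y < \<sigma> * G a \<and> a \<in> {0<..<1}"
      using tendsto_within_subset[OF cont' subset_UNIV] y
      by (intro eventually_conj order_tendstoD(1) eventually_at_leftI[of 0]) auto
    then obtain a where a: "0 < a" "a < 1" "y < \<sigma> * G a"
      using eventually_happens'[OF trivial_limit_at_left_real]
      by (metis (no_types, lifting) greaterThanLessThan_iff)
    have "y < \<sigma> * Q a 1 G" using sandG(1)[of a 1] a by auto
    then have "\<forall>\<^sub>F t in F. y < \<sigma> * Q a 1 (H t)"
      using lim_bump[of a 1] a(1,2) by (intro order_tendstoD(1)[of _ "\<sigma> * Q a 1 G"]) auto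
    then show "\<forall>\<^sub>F t in F. y < \<sigma> * H t 1"
    proof eventually_elim
      case (elim t)
      then show ?case using sandH(2)[of a 1 t] a(1,2) by auto
    qed
  qed
  from tendsto_mult[OF tendsto_const[of "1 / \<sigma>"] this] show ?thesis using \<sigma> by simp
qed

section \<open>Regular variation of monotone sequences\<close>

text \<open>Fixes the extension to real arguments as the step function of the sequence, in place of
  the unspecified \<open>R\<close> of \<open>regularly_varying_seq\<close>. Laplace transforms and
  rescaling then speak about the same function.\<close>

definition step_rv :: "(nat \<Rightarrow> real) \<Rightarrow> real \<Rightarrow> bool" where
  "step_rv D \<rho> \<longleftrightarrow> (\<forall>c>0. ((\<lambda>t::real. D (nat \<lfloor>c * t\<rfloor>) / D (nat \<lfloor>t\<rfloor>)) \<longlongrightarrow> c powr \<rho>) at_top)"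

lemma filterlim_mult_at_top_real:
  fixes c :: real
  assumes "0 < c" shows "filterlim (\<lambda>t. c * t) at_top at_top"
  using assms by (intro filterlim_tendsto_pos_mult_at_top[OF tendsto_const _ filterlim_ident])

lemma filterlim_nat_floor_divide:
  fixes c :: real
  assumes "0 < c" shows "filterlim (\<lambda>t. nat \<lfloor>t / c\<rfloor>) sequentially at_top"
  unfolding filterlim_at_top
proof
  fix Z :: nat
  have "\<forall>\<^sub>F t in at_top. c * real Z \<le> t" by (rule eventually_ge_at_top)
  then show "\<forall>\<^sub>F t in at_top. Z \<le> nat \<lfloor>t / c\<rfloor>"
    by eventually_elim (use assms in \<open>simp add: le_nat_floor field_simps\<close>)
qed

text \<open>Write the dilation ratio of \<open>W\<close> as that of \<open>b\<close> times the
  quotient of \<open>W / b\<close> at the two arguments; the latter tends to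
  \<open>c / c\<close>.\<close>

lemma step_rv_tendsto_ratio:
  assumes rv: "step_rv b \<beta>" and pos: "\<And>n. 0 < b n" and c: "c \<noteq> 0"
    and lim: "((\<lambda>t::real. W (nat \<lfloor>t\<rfloor>) / b (nat \<lfloor>t\<rfloor>)) \<longlongrightarrow> c) at_top"
  shows "step_rv W \<beta>"
  unfolding step_rv_def
proof (intro allI impI)
  fix l :: real assume l: "0 < l"
  have b: "((\<lambda>t::real. b (nat \<lfloor>l * t\<rfloor>) / b (nat \<lfloor>t\<rfloor>)) \<longlongrightarrow> l powr \<beta>) at_top"
    using rv l by (simp add: step_rv_def)
  have "((\<lambda>t::real. W (nat \<lfloor>l * t\<rfloor>) / b (nat \<lfloor>l * t\<rfloor>) * (b (nat \<lfloor>l * t\<rfloor>) / b (nat \<lfloor>t\<rfloor>))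
      / (W (nat \<lfloor>t\<rfloor>) / b (nat \<lfloor>t\<rfloor>))) \<longlongrightarrow> c * l powr \<beta> / c) at_top"
    using c by (intro tendsto_intros b lim
        filterlim_compose[OF lim filterlim_mult_at_top_real[OF l]]) auto
  moreover have "W (nat \<lfloor>l * t\<rfloor>) / b (nat \<lfloor>l * t\<rfloor>) * (b (nat \<lfloor>l * t\<rfloor>) / b (nat \<lfloor>t\<rfloor>))
      / (W (nat \<lfloor>t\<rfloor>) / b (nat \<lfloor>t\<rfloor>)) = W (nat \<lfloor>l * t\<rfloor>) / W (nat \<lfloor>t\<rfloor>)" for t :: real
    using pos[of "nat \<lfloor>t\<rfloor>"] pos[of "nat \<lfloor>l * t\<rfloor>"] by (simp add: field_simps)
  ultimately show "((\<lambda>t::real. W (nat \<lfloor>l * t\<rfloor>) / W (nat \<lfloor>t\<rfloor>)) \<longlongrightarrow> l powr \<beta>) at_top"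
    by (simp only: nonzero_mult_div_cancel_left[OF c])
qed

lemma measurable_step [measurable]:
  fixes D :: "nat \<Rightarrow> real" and c :: real
  shows "(\<lambda>x. D (nat \<lfloor>c * x\<rfloor>)) \<in> borel_measurable borel"
    "(\<lambda>x::real. D (nat \<lfloor>x\<rfloor>)) \<in> borel_measurable borel"
  by measurable

lemma step_rv_imp_regularly_varying_seq:
  assumes "\<And>n. 0 < W n" "step_rv W \<beta>"
  shows "regularly_varying_seq W \<beta>"
  unfolding regularly_varying_seq_def
proof (intro exI conjI allI impI)
  show "regularly_varying (\<lambda>t. W (nat \<lfloor>t\<rfloor>)) \<beta>"
    using assms unfolding regularly_varying_def step_rv_def
    by (auto intro!: measurable_restrict_space1 exI[of _ 1])
qed simp

lemma rational_between_nats: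
  fixes x y :: real
  assumes "0 \<le> x" "x < y"
  obtains p q :: nat where "0 < p" "0 < q" "x < real p / real q" "real p / real q < y"
proof -
  obtain r where r: "r \<in> \<rat>" "x < r" "r < y" using Rats_dense_in_real[OF assms(2)] by auto
  then obtain p q :: nat where "q \<noteq> 0" "\<bar>r\<bar> = real p / real q" by (elim Rats_abs_nat_div_natE)
  with r assms show ?thesis by (intro that[of p q]) (auto intro!: Nat.gr0I)
qed

text \<open>Regular variation along the integers suffices for monotone sequences: the arguments
  \<open>c * t\<close> and \<open>t\<close> are compared with integer multiples \<open>p * k\<close> and \<open>q * k\<close> of the same integer
  \<open>k\<close>, where \<open>p / q\<close> is a rational close to \<open>c\<close>, so no uniform convergence theorem is needed.\<close>

lemma regularly_varying_seq_imp_step_rv: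
  assumes rv: "regularly_varying_seq b \<beta>" and inc: "incseq b" and pos: "\<And>n. 0 < b n"
  shows "step_rv b \<beta>"
proof -
  obtain R where R: "regularly_varying R \<beta>" "\<And>n. 1 \<le> n \<Longrightarrow> b n = R (real n)"
    using rv by (auto simp: regularly_varying_seq_def)
  \<comment> \<open>The sequence determines \<open>R\<close> at integers only, so integer dilations
    are what transfers directly. Quotients of two of them then give all positive rational
    factors.\<close>
  have mult: "(\<lambda>k. b (p * k) / b k) \<longlonglongrightarrow> real p powr \<beta>" if p: "0 < p" for p
  proof -
    have "((\<lambda>t. R (real p * t) / R t) \<longlongrightarrow> real p powr \<beta>) at_top"
      using R(1) p by (auto simp: regularly_varying_def)
    from filterlim_compose[OF this filterlim_real_sequentially]
    show ?thesis
    proof (rule Lim_transform_eventually)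
      show "\<forall>\<^sub>F k in sequentially. R (real p * real k) / R (real k) = b (p * k) / b k"
        using eventually_ge_at_top[of 1]
        by eventually_elim (use p in \<open>simp add: R(2) Suc_le_eq\<close>)
    qed
  qed
  have ratio: "(\<lambda>k. b (p * k) / b (q * k)) \<longlonglongrightarrow> (real p / real q) powr \<beta>"
    if pq: "0 < p" "0 < q" for p q
  proof -
    have "(\<lambda>k. (b (p * k) / b k) / (b (q * k) / b k)) \<longlonglongrightarrow> real p powr \<beta> / real q powr \<beta>"
      using pq by (intro tendsto_divide mult) auto
    moreover have "(b (p * k) / b k) / (b (q * k) / b k) = b (p * k) / b (q * k)" for k
      using pos[of k] by simp
    ultimately show ?thesis by (simp only: powr_divide of_nat_0_le_iff)
  qed
  have mono: "b m / b n \<le> b m' / b n'" if "m \<le> m'" "n' \<le> n" for m n m' n'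
    using pos incseqD[OF inc that(1)] incseqD[OF inc that(2)] by (intro frac_le) (auto intro: less_imp_le)
  show ?thesis
    unfolding step_rv_def
  proof (intro allI impI order_tendstoI)
    fix c y :: real assume c: "0 < c" and y: "c powr \<beta> < y"
    have "((\<lambda>x. x powr \<beta>) \<longlongrightarrow> c powr \<beta>) (at_right c)"
      using c by (intro tendsto_intros) auto
    from order_tendstoD(2)[OF this y] obtain d where d: "c < d" "\<And>r. c < r \<Longrightarrow> r < d \<Longrightarrow> r powr \<beta> < y"
      unfolding eventually_at_right_field by blast
    obtain p q where pq: "0 < p" "0 < q" "c < real p / real q" "real p / real q < d"
      using rational_between_nats[of c d] c d(1) by auto
    have pc: "0 < real p - c * real q" using pq by (simp add: field_simps)
    have "\<forall>\<^sub>F k in sequentially. b (p * k) / b (q * k) < y"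
      using ratio[OF pq(1,2)] d(2)[OF pq(3,4)] by (rule order_tendstoD)
    \<comment> \<open>From this \<open>k\<close> on, \<open>c * q * (k + 1) \<le> p * k\<close>: the
      gap between \<open>c\<close> and \<open>p / q\<close> absorbs the unit lost when
      \<open>t / q\<close> is rounded down.\<close>
    moreover have "\<forall>\<^sub>F k in sequentially. c * real q / (real p - c * real q) \<le> real k"
      using filterlim_real_sequentially unfolding filterlim_at_top by blast
    ultimately have "\<forall>\<^sub>F k in sequentially. b (p * k) / b (q * k) < y
        \<and> c * real q / (real p - c * real q) \<le> real k" by (rule eventually_conj)
    moreover have "filterlim (\<lambda>t. nat \<lfloor>t / real q\<rfloor>) sequentially at_top"
      using pq by (intro filterlim_nat_floor_divide) auto
    ultimately have "\<forall>\<^sub>F t in at_top. b (p * nat \<lfloor>t / real q\<rfloor>) / b (q * nat \<lfloor>t / real q\<rfloor>) < y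
        \<and> c * real q / (real p - c * real q) \<le> real (nat \<lfloor>t / real q\<rfloor>)"
      by (rule eventually_compose_filterlim)
    then show "\<forall>\<^sub>F t in at_top. b (nat \<lfloor>c * t\<rfloor>) / b (nat \<lfloor>t\<rfloor>) < y"
      using eventually_ge_at_top[of "0::real"]
    proof eventually_elim
      case (elim t)
      define k where "k = nat \<lfloor>t / real q\<rfloor>"
      have k: "real k \<le> t / real q" "t / real q < real k + 1"
        using elim(2) pq unfolding k_def by (auto simp: of_nat_nat)
      have kc: "c * (real q * (real k + 1)) \<le> real p * real k"
        using elim pc by (simp add: k_def[symmetric] field_simps)
      have "t < real q * (real k + 1)" using k(2) pq by (simp add: field_simps)
      then have "c * t < c * (real q * (real k + 1))" using c by (rule mult_strict_left_mono)
      then have "c * t < real (p * k)" using kc by simp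
      then have "nat \<lfloor>c * t\<rfloor> \<le> p * k" by linarith
      moreover have "q * k \<le> nat \<lfloor>t\<rfloor>"
        using k(1) pq by (intro le_nat_floor) (simp add: field_simps)
      ultimately show ?case using mono[of "nat \<lfloor>c * t\<rfloor>" "p * k" "q * k" "nat \<lfloor>t\<rfloor>"] elim(1)
        by (simp add: k_def)
    qed
  next
    fix c y :: real assume c: "0 < c" and y: "y < c powr \<beta>"
    have "((\<lambda>x. x powr \<beta>) \<longlongrightarrow> c powr \<beta>) (at_left c)"
      using c by (intro tendsto_intros) auto
    from order_tendstoD(1)[OF this y] obtain d where d: "d < c" "\<And>r. d < r \<Longrightarrow> r < c \<Longrightarrow> y < r powr \<beta>"
      unfolding eventually_at_left_field by blast
    obtain p q where pq: "0 < p" "0 < q" "max 0 d < real p / real q" "real p / real q < c"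
      using rational_between_nats[of "max 0 d" c] c d(1) by auto
    have pc: "0 < c * real q - real p" using pq by (simp add: field_simps)
    \<comment> \<open>For the lower estimate the denominator has to be bounded from above, so
      \<open>t / q\<close> is rounded up to \<open>Suc k\<close>. The bound on \<open>k\<close>
      below makes \<open>p * (k + 1) \<le> c * q * k\<close>.\<close>
    have "\<forall>\<^sub>F k in sequentially. y < b (p * Suc k) / b (q * Suc k)"
      using LIMSEQ_Suc[OF ratio[OF pq(1,2)]] d(2)[of "real p / real q"] pq
      by (intro order_tendstoD(1)) auto
    moreover have "\<forall>\<^sub>F k in sequentially. real p / (c * real q - real p) \<le> real k"
      using filterlim_real_sequentially unfolding filterlim_at_top by blast
    ultimately have "\<forall>\<^sub>F k in sequentially. y < b (p * Suc k) / b (q * Suc k)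
        \<and> real p / (c * real q - real p) \<le> real k" by (rule eventually_conj)
    moreover have "filterlim (\<lambda>t. nat \<lfloor>t / real q\<rfloor>) sequentially at_top"
      using pq by (intro filterlim_nat_floor_divide) auto
    ultimately have "\<forall>\<^sub>F t in at_top.
        y < b (p * Suc (nat \<lfloor>t / real q\<rfloor>)) / b (q * Suc (nat \<lfloor>t / real q\<rfloor>))
        \<and> real p / (c * real q - real p) \<le> real (nat \<lfloor>t / real q\<rfloor>)"
      by (rule eventually_compose_filterlim)
    then show "\<forall>\<^sub>F t in at_top. y < b (nat \<lfloor>c * t\<rfloor>) / b (nat \<lfloor>t\<rfloor>)"
      using eventually_ge_at_top[of "0::real"]
    proof eventually_elim
      case (elim t)
      define k where "k = nat \<lfloor>t / real q\<rfloor>"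
      have k: "real k \<le> t / real q" "t / real q < real k + 1"
        using elim(2) pq unfolding k_def by (auto simp: of_nat_nat)
      have kc: "real p * (real k + 1) \<le> c * (real q * real k)"
        using elim pc by (simp add: k_def[symmetric] field_simps)
      have "c * (real q * real k) \<le> c * t"
        using k(1) pq c by (intro mult_left_mono) (auto simp: field_simps)
      then have "p * Suc k \<le> nat \<lfloor>c * t\<rfloor>"
        using kc by (intro le_nat_floor) (simp add: algebra_simps)
      moreover have "t < real (q * Suc k)" using k(2) pq by (simp add: field_simps)
      then have "nat \<lfloor>t\<rfloor> \<le> q * Suc k" by linarith
      ultimately have "b (p * Suc k) / b (q * Suc k) \<le> b (nat \<lfloor>c * t\<rfloor>) / b (nat \<lfloor>t\<rfloor>)"
        by (rule mono)
      then show ?case using elim(1) by (simp add: k_def)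
    qed
  qed
qed

text \<open>A one-sided Potter bound, which supplies the majorants for dominated convergence. Since
  \<beta> < \<gamma>, doubling a large argument multiplies \<open>b\<close> by at most
  \<open>2 powr \<gamma>\<close>; iteration reaches the powers of 2 and monotonicity fills the
  gaps.\<close>

lemma step_rv_Potter_bound:
  assumes rv: "step_rv b \<beta>" and inc: "incseq b" and pos: "\<And>n. 0 < b n"
    and \<gamma>: "\<beta> < \<gamma>" "0 < \<gamma>"
  obtains C t0 where "0 < C" "1 \<le> t0"
    "\<And>s t :: real. 0 < s \<Longrightarrow> s \<le> t \<Longrightarrow> t0 \<le> t \<Longrightarrow>
      b (nat \<lfloor>t\<rfloor>) \<le> C * (t / s) powr \<gamma> * b (nat \<lfloor>s\<rfloor>)"
proof -
  define B where "B t = b (nat \<lfloor>t\<rfloor>)" for t :: real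
  have Bpos: "0 < B t" for t by (simp add: B_def pos)
  have Bmono: "B s \<le> B t" if "s \<le> t" for s t
    unfolding B_def using that by (intro incseqD[OF inc] nat_mono floor_mono)
  have "((\<lambda>t. B (2 * t) / B t) \<longlongrightarrow> 2 powr \<beta>) at_top"
    using rv by (simp add: step_rv_def B_def)
  moreover have "(2::real) powr \<beta> < 2 powr \<gamma>" using \<gamma> by simp
  ultimately have "\<forall>\<^sub>F t in at_top. B (2 * t) / B t < 2 powr \<gamma>" by (rule order_tendstoD)
  then obtain t1 where t1: "\<And>t. t1 \<le> t \<Longrightarrow> B (2 * t) / B t < 2 powr \<gamma>"
    by (auto simp: eventually_at_top_linorder)
  define t0 where "t0 = max 1 t1"
  have dbl: "B (2 * t) \<le> 2 powr \<gamma> * B t" if "t0 \<le> t" for t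
    using t1[of t] that Bpos[of t] by (simp add: t0_def field_simps)
  have pow: "B (2 ^ k * s) \<le> (2 ^ k) powr \<gamma> * B s" if s: "t0 \<le> s" for s k
  proof (induction k)
    case (Suc k)
    have "1 * s \<le> 2 ^ k * s" using s by (intro mult_right_mono) (auto simp: t0_def)
    then have "B (2 * (2 ^ k * s)) \<le> 2 powr \<gamma> * B (2 ^ k * s)" using s by (intro dbl) simp
    also have "\<dots> \<le> 2 powr \<gamma> * ((2 ^ k) powr \<gamma> * B s)" by (intro mult_left_mono Suc) auto
    finally show ?case by (simp add: powr_mult mult.assoc)
  qed (simp)
  have large: "B t \<le> 2 powr \<gamma> * (t / s) powr \<gamma> * B s" if st: "t0 \<le> s" "s \<le> t" for s t
  proof -
    have s0: "0 < s" using st by (simp add: t0_def)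
    \<comment> \<open>The number of doublings that takes \<open>s\<close> to \<open>t\<close> or
      beyond. Rounding up overshoots by at most one doubling, whence the factor
      \<open>2 powr \<gamma>\<close>.\<close>
    define k where "k = nat \<lceil>log 2 (t / s)\<rceil>"
    have l0: "0 \<le> log 2 (t / s)" using st s0 by (simp add: zero_le_log_cancel_iff)
    have k: "log 2 (t / s) \<le> real k" "real k \<le> log 2 (t / s) + 1"
      unfolding k_def using l0 by linarith+
    have "t / s = 2 powr log 2 (t / s)" using s0 st by simp
    also have "\<dots> \<le> 2 powr real k" using k(1) by (intro powr_mono) auto
    finally have k1: "t \<le> 2 ^ k * s" using s0 by (simp add: powr_realpow field_simps)
    have "(2::real) ^ k = 2 powr real k" by (simp add: powr_realpow)
    also have "\<dots> \<le> 2 powr (log 2 (t / s) + 1)" using k(2) by (intro powr_mono) auto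
    also have "\<dots> = 2 * (t / s)" using s0 st by (simp add: powr_add)
    finally have k2: "(2::real) ^ k \<le> 2 * (t / s)" .
    have "B t \<le> B (2 ^ k * s)" by (rule Bmono[OF k1])
    also have "\<dots> \<le> (2 ^ k) powr \<gamma> * B s" by (rule pow[OF st(1)])
    also have "\<dots> \<le> (2 * (t / s)) powr \<gamma> * B s"
      using k2 \<gamma> Bpos[of s] by (intro mult_right_mono powr_mono2) auto
    also have "\<dots> = 2 powr \<gamma> * (t / s) powr \<gamma> * B s" using st s0 by (subst powr_mult) auto
    finally show ?thesis .
  qed
  \<comment> \<open>The quotient \<open>B t0 / B 0\<close> pays for \<open>s\<close> below
    \<open>t0\<close>: there the doublings start only at \<open>t0\<close>, and \<open>B s\<close>
    is bounded below by \<open>B 0\<close>.\<close>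
  define C where "C = 2 powr \<gamma> * (B t0 / B 0)"
  have C1: "1 \<le> B t0 / B 0" using Bmono[of 0 t0] Bpos[of 0] by (simp add: t0_def)
  have C: "2 powr \<gamma> \<le> C" unfolding C_def using mult_left_mono[OF C1, of "2 powr \<gamma>"] by simp
  show ?thesis
  proof (rule that[of C t0])
    show "0 < C" using C by (rule less_le_trans[rotated]) simp
    show "1 \<le> t0" by (simp add: t0_def)
    fix s t :: real assume st: "0 < s" "s \<le> t" "t0 \<le> t"
    have "B t \<le> C * (t / s) powr \<gamma> * B s"
    proof (cases "t0 \<le> s")
      case True
      have "B t \<le> 2 powr \<gamma> * (t / s) powr \<gamma> * B s" by (rule large[OF True st(2)])
      also have "\<dots> \<le> C * (t / s) powr \<gamma> * B s"
        using C Bpos[of s] by (intro mult_right_mono) auto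
      finally show ?thesis .
    next
      case False
      have "B t \<le> 2 powr \<gamma> * (t / t0) powr \<gamma> * B t0" by (rule large[OF _ st(3)]) simp
      also have "\<dots> = C * (t / t0) powr \<gamma> * B 0" using Bpos[of 0] by (simp add: C_def)
      also have "\<dots> \<le> C * (t / s) powr \<gamma> * B s"
        using False st \<gamma> \<open>0 < C\<close> Bpos[of 0] Bmono[of 0 s]
        by (intro mult_mono powr_mono2 mult_left_mono divide_left_mono mult_pos_pos) (auto simp: t0_def)
      finally show ?thesis .
    qed
    then show "b (nat \<lfloor>t\<rfloor>) \<le> C * (t / s) powr \<gamma> * b (nat \<lfloor>s\<rfloor>)" by (simp add: B_def)
  qed
qed

section \<open>Abelian and Tauberian theorems\<close>

definition step_laplace :: "(nat \<Rightarrow> real) \<Rightarrow> real \<Rightarrow> real" where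
  "step_laplace D s = (\<integral>x. exp (- (s * x)) * D (nat \<lfloor>x\<rfloor>) \<partial>pos_lborel)"

lemma step_laplace_scale:
  assumes "0 < t"
  shows "(\<integral>x. exp (- (l * x)) * D (nat \<lfloor>t * x\<rfloor>) \<partial>pos_lborel) = step_laplace D (l / t) / t"
  using pos_lborel_scale(2)[OF assms, of "\<lambda>x. exp (- (l / t * x)) * D (nat \<lfloor>x\<rfloor>)"] assms
  by (simp add: step_laplace_def)

lemma step_laplace_scale_integrable:
  assumes "0 < t" "integrable pos_lborel (\<lambda>x. exp (- (l / t * x)) * D (nat \<lfloor>x\<rfloor>))"
  shows "integrable pos_lborel (\<lambda>x. exp (- (l * x)) * D (nat \<lfloor>t * x\<rfloor>))"
  using pos_lborel_scale(1)[OF assms(1), of "\<lambda>x. exp (- (l / t * x)) * D (nat \<lfloor>x\<rfloor>)"] assms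
  by simp

text \<open>On each unit interval the step function is constant and the exponential integrates
  explicitly. The transform thus becomes a power series at \<open>exp (- s)\<close>, in which
  convolutions of sequences are Cauchy products.\<close>

lemma step_laplace_series:
  assumes D: "\<And>k. 0 \<le> D k" and s: "0 < s" and sm: "summable (\<lambda>k. D k * exp (- s) ^ k)"
  shows "integrable pos_lborel (\<lambda>x. exp (- (s * x)) * D (nat \<lfloor>x\<rfloor>))"
    and "step_laplace D s = (1 - exp (- s)) / s * (\<Sum>k. D k * exp (- s) ^ k)"
proof -
  have piece: "(\<integral>\<^sup>+x. ennreal (exp (- (s * x))) * indicator ({real k..<real (Suc k)} \<inter> {0<..}) x \<partial>lborel)
      = ennreal ((1 - exp (- s)) / s * exp (- s) ^ k)" (is "?L = _") for k
  proof -
    \<comment> \<open>End points are null, so the half-open piece, without 0 when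
      \<open>k = 0\<close>, may be replaced by the closed interval for the fundamental theorem of
      calculus.\<close>
    have "AE x in lborel. x \<noteq> 0 \<and> x \<noteq> real (Suc k)"
      using AE_lborel_singleton[of 0] AE_lborel_singleton[of "real (Suc k)"] by eventually_elim simp
    then have "?L = (\<integral>\<^sup>+x. ennreal (exp (- (s * x))) * indicator {real k..real (Suc k)} x \<partial>lborel)"
      by (intro nn_integral_cong_AE, elim eventually_mono) (auto simp: indicator_def)
    also have "\<dots> = ennreal (- exp (- (s * real (Suc k))) / s - - exp (- (s * real k)) / s)"
      using s by (intro nn_integral_FTC_Icc)
        (auto intro!: derivative_eq_intros simp: has_real_derivative_iff_has_vector_derivative[symmetric])
    also have "- exp (- (s * real (Suc k))) / s - - exp (- (s * real k)) / s
        = (1 - exp (- s)) / s * exp (- s) ^ k"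
    proof -
      have "exp (- (s * real n)) = exp (- s) ^ n" for n
        using exp_of_nat_mult[of n "- s"] by (simp only: mult_minus_right mult.commute[of s])
      then show ?thesis using s by (simp only: power_Suc) (simp add: field_simps)
    qed
    finally show ?thesis .
  qed
  have c: "0 \<le> (1 - exp (- s)) / s" using s by simp
  have "(\<integral>\<^sup>+x. ennreal (exp (- (s * x)) * D (nat \<lfloor>x\<rfloor>)) \<partial>pos_lborel)
      = (\<integral>\<^sup>+x. ennreal (exp (- (s * x)) * D (nat \<lfloor>x\<rfloor>)) * indicator {0<..} x \<partial>lborel)"
    by (simp add: nn_integral_restrict_space)
  also have "\<dots> = (\<integral>\<^sup>+x. (\<Sum>k. ennreal (D k) * (ennreal (exp (- (s * x)))
      * indicator ({real k..<real (Suc k)} \<inter> {0<..}) x)) \<partial>lborel)"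
  proof (rule nn_integral_cong)
    fix x :: real
    show "ennreal (exp (- (s * x)) * D (nat \<lfloor>x\<rfloor>)) * indicator {0<..} x
      = (\<Sum>k. ennreal (D k) * (ennreal (exp (- (s * x)))
          * indicator ({real k..<real (Suc k)} \<inter> {0<..}) x))"
    proof (cases "0 < x")
      case True
      have eq: "real k \<le> x \<and> x < 1 + real k \<longleftrightarrow> k = nat \<lfloor>x\<rfloor>" for k
        using True by linarith
      have "(\<Sum>k. ennreal (D k) * (ennreal (exp (- (s * x)))
          * indicator ({real k..<real (Suc k)} \<inter> {0<..}) x)) =
        (\<Sum>k\<in>{nat \<lfloor>x\<rfloor>}. ennreal (D k) * (ennreal (exp (- (s * x)))
          * indicator ({real k..<real (Suc k)} \<inter> {0<..}) x))"
        by (rule suminf_finite) (auto simp: indicator_def eq)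
      then show ?thesis
        using True D eq[of "nat \<lfloor>x\<rfloor>"] by (simp add: indicator_def ennreal_mult mult.commute)
    qed simp
  qed
  also have "\<dots> = (\<Sum>k. ennreal (D k * ((1 - exp (- s)) / s * exp (- s) ^ k)))"
  proof (subst nn_integral_suminf)
    have "(\<integral>\<^sup>+x. ennreal (D k) * (ennreal (exp (- (s * x)))
          * indicator ({real k..<real (Suc k)} \<inter> {0<..}) x) \<partial>lborel)
        = ennreal (D k * ((1 - exp (- s)) / s * exp (- s) ^ k))" for k
      unfolding ennreal_mult'[OF D] piece[symmetric] by (rule nn_integral_cmult) measurable
    then show "(\<Sum>k. \<integral>\<^sup>+x. ennreal (D k) * (ennreal (exp (- (s * x)))
          * indicator ({real k..<real (Suc k)} \<inter> {0<..}) x) \<partial>lborel)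
        = (\<Sum>k. ennreal (D k * ((1 - exp (- s)) / s * exp (- s) ^ k)))" by (simp only:)
  qed measurable
  also have "\<dots> = (\<Sum>k. ennreal ((1 - exp (- s)) / s * (D k * exp (- s) ^ k)))"
    unfolding mult.left_commute[of "D _"] ..
  also have "\<dots> = ennreal (\<Sum>k. (1 - exp (- s)) / s * (D k * exp (- s) ^ k))"
  proof (rule suminf_ennreal2)
    show "0 \<le> (1 - exp (- s)) / s * (D k * exp (- s) ^ k)" for k
      using c D by (intro mult_nonneg_nonneg) auto
  qed (rule summable_mult[OF sm])
  also have "(\<Sum>k. (1 - exp (- s)) / s * (D k * exp (- s) ^ k))
      = (1 - exp (- s)) / s * (\<Sum>k. D k * exp (- s) ^ k)"
    by (rule suminf_mult[OF sm])
  finally have "has_bochner_integral pos_lborel (\<lambda>x. exp (- (s * x)) * D (nat \<lfloor>x\<rfloor>))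
      ((1 - exp (- s)) / s * (\<Sum>k. D k * exp (- s) ^ k))"
  proof (intro has_bochner_integral_nn_integral AE_I2)
    show "0 \<le> (1 - exp (- s)) / s * (\<Sum>k. D k * exp (- s) ^ k)"
      using D by (intro mult_nonneg_nonneg c suminf_nonneg sm) auto
    show "(\<lambda>x. exp (- (s * x)) * D (nat \<lfloor>x\<rfloor>)) \<in> borel_measurable pos_lborel"
      by (rule measurable_pos_lborel) measurable
  qed (simp add: D)
  then show "integrable pos_lborel (\<lambda>x. exp (- (s * x)) * D (nat \<lfloor>x\<rfloor>))"
    and "step_laplace D s = (1 - exp (- s)) / s * (\<Sum>k. D k * exp (- s) ^ k)"
    by (auto simp: has_bochner_integral_iff step_laplace_def)
qed

lemma summable_bounded_mult_power:
  fixes D :: "nat \<Rightarrow> real"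
  assumes "\<And>k. 0 \<le> D k" "\<And>k. D k \<le> K" "0 \<le> z" "z < 1"
  shows "summable (\<lambda>k. D k * z ^ k)"
proof (rule summable_comparison_test')
  show "summable (\<lambda>k. K * z ^ k)" using assms by (intro summable_mult summable_geometric) auto
  show "norm (D k * z ^ k) \<le> K * z ^ k" if "0 \<le> k" for k
    using assms by (auto simp: abs_mult intro!: mult_right_mono)
qed

text \<open>After substituting \<open>t * y\<close> for the variable, this is dominated convergence
  towards the Gamma integral. The normalisation \<open>m\<close> and the majorant \<open>w\<close>
  are parameters, since the argument serves \<open>b\<close>, its reciprocal and a convergent
  sequence.\<close>

lemma abelian_step_laplace:
  fixes D :: "nat \<Rightarrow> real" and m w :: "real \<Rightarrow> real"
  assumes \<rho>: "- 1 < \<rho>"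
    and lim: "\<And>y. 0 < y \<Longrightarrow> ((\<lambda>t. m t * D (nat \<lfloor>t * y\<rfloor>)) \<longlongrightarrow> y powr \<rho>) at_top"
    and w: "integrable pos_lborel w"
    and dom: "\<And>t y. a \<le> t \<Longrightarrow> 0 < y \<Longrightarrow> exp (- y) * \<bar>m t * D (nat \<lfloor>t * y\<rfloor>)\<bar> \<le> w y"
  shows "((\<lambda>t. m t * step_laplace D (1 / t) / t) \<longlongrightarrow> Gamma (1 + \<rho>)) at_top"
proof -
  have "((\<lambda>t. \<integral>y. exp (- (1 * y)) * (m t * D (nat \<lfloor>t * y\<rfloor>)) \<partial>pos_lborel) \<longlongrightarrow>
      (\<integral>y. exp (- (1 * y)) * y powr \<rho> \<partial>pos_lborel)) at_top"
  proof (rule integral_dominated_convergence_at_top[OF _ _ w])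
    show "AE y in pos_lborel. ((\<lambda>t. exp (- (1 * y)) * (m t * D (nat \<lfloor>t * y\<rfloor>))) \<longlongrightarrow>
        exp (- (1 * y)) * y powr \<rho>) at_top"
      by (intro AE_I2 tendsto_mult_left lim) (simp add: space_pos_lborel)
    show "\<forall>\<^sub>F t in at_top. AE y in pos_lborel. norm (exp (- (1 * y)) * (m t * D (nat \<lfloor>t * y\<rfloor>))) \<le> w y"
      using eventually_ge_at_top[of a]
    proof eventually_elim
      case (elim t)
      show ?case
        by (intro AE_I2) (use dom[OF elim] in \<open>simp add: space_pos_lborel abs_mult\<close>)
    qed
  qed (auto intro!: measurable_pos_lborel borel_measurable_times)
  moreover have "(\<integral>y. exp (- (1 * y)) * y powr \<rho> \<partial>pos_lborel) = Gamma (1 + \<rho>)"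
    using laplace_powr(2)[OF \<rho>, of 1] by simp
  ultimately have "((\<lambda>t. \<integral>y. exp (- (1 * y)) * (m t * D (nat \<lfloor>t * y\<rfloor>)) \<partial>pos_lborel) \<longlongrightarrow> Gamma (1 + \<rho>)) at_top"
    by simp
  then show ?thesis
  proof (rule Lim_transform_eventually)
    show "\<forall>\<^sub>F t in at_top. (\<integral>y. exp (- (1 * y)) * (m t * D (nat \<lfloor>t * y\<rfloor>)) \<partial>pos_lborel)
        = m t * step_laplace D (1 / t) / t"
      using eventually_gt_at_top[of 0]
    proof eventually_elim
      case (elim t)
      have "(\<integral>y. exp (- (1 * y)) * (m t * D (nat \<lfloor>t * y\<rfloor>)) \<partial>pos_lborel)
          = (\<integral>y. m t * (exp (- (1 * y)) * D (nat \<lfloor>t * y\<rfloor>)) \<partial>pos_lborel)"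
        by (simp add: mult.left_commute)
      also have "\<dots> = m t * (\<integral>y. exp (- (1 * y)) * D (nat \<lfloor>t * y\<rfloor>) \<partial>pos_lborel)"
        by (rule integral_mult_right_zero)
      finally show ?case using step_laplace_scale[OF elim, of 1 D] by simp
    qed
  qed
qed

text \<open>Monotonicity bounds the ratio by 1 for \<open>y \<le> 1\<close>, the Potter bound for
  larger \<open>y\<close>. The exponent \<open>\<beta> + 1\<close> is a convenient one above
  \<beta>, as the exponential dominates every power.\<close>

lemma abelian_increasing:
  assumes rv: "step_rv b \<beta>" and inc: "incseq b" and pos: "\<And>n. 0 < b n" and \<beta>: "0 \<le> \<beta>"
  shows "((\<lambda>t. step_laplace b (1 / t) / (t * b (nat \<lfloor>t\<rfloor>))) \<longlongrightarrow> Gamma (1 + \<beta>)) at_top"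
proof -
  obtain C t0 where C: "0 < C" "1 \<le> t0"
    and potter: "\<And>s t :: real. 0 < s \<Longrightarrow> s \<le> t \<Longrightarrow> t0 \<le> t \<Longrightarrow>
      b (nat \<lfloor>t\<rfloor>) \<le> C * (t / s) powr (\<beta> + 1) * b (nat \<lfloor>s\<rfloor>)"
    using step_rv_Potter_bound[OF rv inc pos, of "\<beta> + 1"] \<beta> by auto
  have "((\<lambda>t. 1 / b (nat \<lfloor>t\<rfloor>) * step_laplace b (1 / t) / t) \<longlongrightarrow> Gamma (1 + \<beta>)) at_top"
  proof (rule abelian_step_laplace[where a = t0])
    show "- 1 < \<beta>" using \<beta> by simp
    show "((\<lambda>t. 1 / b (nat \<lfloor>t\<rfloor>) * b (nat \<lfloor>t * y\<rfloor>)) \<longlongrightarrow> y powr \<beta>) at_top" if "0 < y" for y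
      using rv that by (simp add: step_rv_def mult.commute[of _ y])
    show "integrable pos_lborel (\<lambda>y. exp (- (1 * y)) * y powr 0 + C * (exp (- (1 * y)) * y powr (\<beta> + 1)))"
      using \<beta> by (intro Bochner_Integration.integrable_add integrable_mult_right laplace_powr) auto
    fix t y :: real assume t: "t0 \<le> t" and y: "0 < y"
    have "b (nat \<lfloor>t * y\<rfloor>) \<le> (1 + C * y powr (\<beta> + 1)) * b (nat \<lfloor>t\<rfloor>)"
    proof (cases "y \<le> 1")
      case True
      then have "t * y \<le> t" using t C by (simp add: mult_le_cancel_left1)
      then have "b (nat \<lfloor>t * y\<rfloor>) \<le> 1 * b (nat \<lfloor>t\<rfloor>)"
        using incseqD[OF inc] by (simp add: nat_mono floor_mono)
      also have "\<dots> \<le> (1 + C * y powr (\<beta> + 1)) * b (nat \<lfloor>t\<rfloor>)"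
        using C pos[of "nat \<lfloor>t\<rfloor>"] by (intro mult_right_mono) auto
      finally show ?thesis .
    next
      case False
      have t': "t \<le> t * y" using t C False by simp
      have "b (nat \<lfloor>t * y\<rfloor>) \<le> C * (t * y / t) powr (\<beta> + 1) * b (nat \<lfloor>t\<rfloor>)"
        by (rule potter) (use t' t C in linarith)+
      also have "\<dots> \<le> (1 + C * y powr (\<beta> + 1)) * b (nat \<lfloor>t\<rfloor>)"
        using C t pos[of "nat \<lfloor>t\<rfloor>"] by (intro mult_right_mono) auto
      finally show ?thesis .
    qed
    then have "\<bar>1 / b (nat \<lfloor>t\<rfloor>) * b (nat \<lfloor>t * y\<rfloor>)\<bar> \<le> 1 + C * y powr (\<beta> + 1)"
      using pos[of "nat \<lfloor>t\<rfloor>"] pos[of "nat \<lfloor>t * y\<rfloor>"] by (simp add: pos_divide_le_eq)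
    from mult_left_mono[OF this, of "exp (- y)"]
    show "exp (- y) * \<bar>1 / b (nat \<lfloor>t\<rfloor>) * b (nat \<lfloor>t * y\<rfloor>)\<bar>
        \<le> exp (- (1 * y)) * y powr 0 + C * (exp (- (1 * y)) * y powr (\<beta> + 1))"
      using y by (simp add: algebra_simps)
  qed
  then show ?thesis by (simp add: mult.commute)
qed

lemma step_rv_inverse:
  assumes "step_rv b \<beta>"
  shows "step_rv (\<lambda>n. 1 / b n) (- \<beta>)"
  unfolding step_rv_def
proof (intro allI impI)
  fix c :: real assume c: "0 < c"
  have "((\<lambda>t. inverse (b (nat \<lfloor>c * t\<rfloor>) / b (nat \<lfloor>t\<rfloor>))) \<longlongrightarrow> inverse (c powr \<beta>)) at_top"
    using assms c by (intro tendsto_inverse) (auto simp: step_rv_def)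
  then show "((\<lambda>t. 1 / b (nat \<lfloor>c * t\<rfloor>) / (1 / b (nat \<lfloor>t\<rfloor>))) \<longlongrightarrow> c powr - \<beta>) at_top"
    by (simp add: powr_minus divide_inverse mult.commute)
qed

text \<open>Compared with the increasing case the roles of \<open>t\<close> and \<open>t * y\<close>
  are exchanged: the Potter bound is now required near \<open>y = 0\<close>, where the majorant
  \<open>y powr - \<gamma>\<close> is singular.\<close>

lemma abelian_inverse_increasing:
  assumes rv: "step_rv b \<beta>" and inc: "incseq b" and pos: "\<And>n. 0 < b n"
    and \<beta>: "0 \<le> \<beta>" "\<beta> < 1"
  shows "((\<lambda>t. step_laplace (\<lambda>n. 1 / b n) (1 / t) / (t * (1 / b (nat \<lfloor>t\<rfloor>)))) \<longlongrightarrow> Gamma (1 - \<beta>)) at_top"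
proof -
  \<comment> \<open>The midpoint of \<beta> and 1: above \<beta> for the Potter bound, below 1 so
    that \<open>y powr - \<gamma>\<close> is integrable at 0.\<close>
  define \<gamma> where "\<gamma> = (1 + \<beta>) / 2"
  have \<gamma>: "\<beta> < \<gamma>" "0 < \<gamma>" "\<gamma> < 1" using \<beta> by (auto simp: \<gamma>_def)
  obtain C t0 where C: "0 < C" "1 \<le> t0"
    and potter: "\<And>s t :: real. 0 < s \<Longrightarrow> s \<le> t \<Longrightarrow> t0 \<le> t \<Longrightarrow>
      b (nat \<lfloor>t\<rfloor>) \<le> C * (t / s) powr \<gamma> * b (nat \<lfloor>s\<rfloor>)"
    using step_rv_Potter_bound[OF rv inc pos \<gamma>(1,2)] by auto
  have "((\<lambda>t. b (nat \<lfloor>t\<rfloor>) * step_laplace (\<lambda>n. 1 / b n) (1 / t) / t) \<longlongrightarrow> Gamma (1 + - \<beta>)) at_top"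
  proof (rule abelian_step_laplace[where a = t0])
    show "- 1 < - \<beta>" using \<beta> by simp
    show "((\<lambda>t. b (nat \<lfloor>t\<rfloor>) * (1 / b (nat \<lfloor>t * y\<rfloor>))) \<longlongrightarrow> y powr - \<beta>) at_top" if "0 < y" for y
      using step_rv_inverse[OF rv] that by (simp add: step_rv_def mult.commute[of _ y])
    show "integrable pos_lborel (\<lambda>y. exp (- (1 * y)) * y powr 0 + C * (exp (- (1 * y)) * y powr - \<gamma>))"
      using \<gamma> by (intro Bochner_Integration.integrable_add integrable_mult_right laplace_powr) auto
    fix t y :: real assume t: "t0 \<le> t" and y: "0 < y"
    have "b (nat \<lfloor>t\<rfloor>) \<le> (1 + C * y powr - \<gamma>) * b (nat \<lfloor>t * y\<rfloor>)"
    proof (cases "1 \<le> y")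
      case True
      then have "t \<le> t * y" using t C by (simp add: mult_le_cancel_left1)
      then have "b (nat \<lfloor>t\<rfloor>) \<le> 1 * b (nat \<lfloor>t * y\<rfloor>)"
        using incseqD[OF inc] by (simp add: nat_mono floor_mono)
      also have "\<dots> \<le> (1 + C * y powr - \<gamma>) * b (nat \<lfloor>t * y\<rfloor>)"
        using C pos[of "nat \<lfloor>t * y\<rfloor>"] by (intro mult_right_mono) auto
      finally show ?thesis .
    next
      case False
      have t': "t * y \<le> t" using t C False by simp
      have "b (nat \<lfloor>t\<rfloor>) \<le> C * (t / (t * y)) powr \<gamma> * b (nat \<lfloor>t * y\<rfloor>)"
        using t' t C y by (intro potter) auto
      also have "t / (t * y) = inverse y" using t C by (simp add: field_simps)
      also have "inverse y powr \<gamma> = y powr - \<gamma>" using y by (simp add: powr_minus inverse_powr)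
      also have "C * y powr - \<gamma> * b (nat \<lfloor>t * y\<rfloor>) \<le> (1 + C * y powr - \<gamma>) * b (nat \<lfloor>t * y\<rfloor>)"
        using C t pos[of "nat \<lfloor>t * y\<rfloor>"] by (intro mult_right_mono) auto
      finally show ?thesis .
    qed
    then have "\<bar>b (nat \<lfloor>t\<rfloor>) * (1 / b (nat \<lfloor>t * y\<rfloor>))\<bar> \<le> 1 + C * y powr - \<gamma>"
      using pos[of "nat \<lfloor>t\<rfloor>"] pos[of "nat \<lfloor>t * y\<rfloor>"] by (simp add: pos_divide_le_eq)
    from mult_left_mono[OF this, of "exp (- y)"]
    show "exp (- y) * \<bar>b (nat \<lfloor>t\<rfloor>) * (1 / b (nat \<lfloor>t * y\<rfloor>))\<bar>
        \<le> exp (- (1 * y)) * y powr 0 + C * (exp (- (1 * y)) * y powr - \<gamma>)"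
      using y by (simp add: algebra_simps)
  qed
  then show ?thesis by (simp add: mult.commute)
qed

text \<open>By \<open>A\<close> and \<open>P\<close> the transforms of \<open>E\<close>, rescaled by
  \<open>t\<close> and multiplied by \<open>D (nat \<lfloor>t\<rfloor>)\<close>, converge to those
  of a multiple of \<open>x powr - \<rho>\<close>; monotonicity then gives the value at 1. With
  \<sigma> = 1 the sequence \<open>E\<close> increases, with \<sigma> = -1 it decreases, and
  \<open>\<sigma> * \<rho> \<le> 0\<close> makes the limit profile monotone in the same
  sense.\<close>

lemma tauberian_transfer:
  fixes D E :: "nat \<Rightarrow> real" and \<rho> \<sigma> :: real
  assumes \<rho>: "- 1 < \<rho>" "\<rho> < 1" and \<sigma>: "\<sigma> \<noteq> 0" "\<sigma> * \<rho> \<le> 0"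
    and E0: "\<And>n. 0 \<le> E n" and monoE: "mono (\<lambda>n. \<sigma> * E n)"
    and D0: "\<And>n. 0 < D n" and rv: "step_rv D \<rho>"
    and iE: "\<And>s. 0 < s \<Longrightarrow> integrable pos_lborel (\<lambda>x. exp (- (s * x)) * E (nat \<lfloor>x\<rfloor>))"
    and A: "((\<lambda>t. step_laplace D (1 / t) / (t * D (nat \<lfloor>t\<rfloor>))) \<longlongrightarrow> Gamma (1 + \<rho>)) at_top"
    and P: "((\<lambda>t. step_laplace E (1 / t) * step_laplace D (1 / t) / t\<^sup>2) \<longlongrightarrow> 1) at_top"
  shows "((\<lambda>t::real. E (nat \<lfloor>t\<rfloor>) * D (nat \<lfloor>t\<rfloor>)) \<longlongrightarrow> 1 / (Gamma (1 + \<rho>) * Gamma (1 - \<rho>))) at_top"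
proof -
  \<comment> \<open>The transform of \<open>x powr - \<rho> / K\<close> at \<open>l\<close> is
    \<open>Gamma (1 - \<rho>) * l powr (\<rho> - 1) / K\<close>, while \<open>A\<close> and
    \<open>P\<close> force the limit \<open>l powr (\<rho> - 1) / Gamma (1 + \<rho>)\<close>.
    Equating the two gives \<open>K\<close>.\<close>
  define K where "K = Gamma (1 + \<rho>) * Gamma (1 - \<rho>)"
  have G: "0 < Gamma (1 + \<rho>)" "0 < Gamma (1 - \<rho>)" using \<rho> by (auto intro!: Gamma_real_pos)
  then have K: "0 < K" by (simp add: K_def)
  \<comment> \<open>The maximum keeps the scale positive, so that integrability and monotonicity
    hold for every real \<open>t\<close>; from \<open>t = 1\<close> on it is \<open>t\<close>
    itself.\<close>
  define H where "H t x = E (nat \<lfloor>max 1 t * x\<rfloor>) * D (nat \<lfloor>t\<rfloor>)" for t x :: real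
  have "((\<lambda>t. H t 1) \<longlongrightarrow> 1 powr (- \<rho>) / K) at_top"
  proof (rule laplace_tendsto_monotone[where \<sigma> = \<sigma>])
    show "H t \<in> borel_measurable pos_lborel" for t
      unfolding H_def by (intro measurable_pos_lborel) measurable
    show "(\<lambda>x. x powr - \<rho> / K) \<in> borel_measurable pos_lborel"
      by (intro measurable_pos_lborel) measurable
    show "0 \<le> H t x" for t x using E0 D0[THEN less_imp_le] by (simp add: H_def)
    show "0 \<le> x powr - \<rho> / K" for x using K by simp
    have scale: "exp (- (l * x)) * H t x = D (nat \<lfloor>t\<rfloor>) * (exp (- (l * x)) * E (nat \<lfloor>max 1 t * x\<rfloor>))"
      for t x l by (simp add: H_def)
    show "integrable pos_lborel (\<lambda>x. exp (- (real (Suc n) * x)) * H t x)" for t n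
      unfolding scale by (intro integrable_mult_right step_laplace_scale_integrable iE) auto
    have GG: "exp (- (l * x)) * (x powr - \<rho> / K) = (exp (- (l * x)) * x powr - \<rho>) / K" for l x by simp
    show "integrable pos_lborel (\<lambda>x. exp (- (real (Suc n) * x)) * (x powr - \<rho> / K))" for n
      unfolding GG using \<rho> by (intro integrable_divide_zero laplace_powr) auto
    show "mono_on {0<..} (\<lambda>x. \<sigma> * H t x)" for t
    proof (rule mono_onI)
      fix x y :: real assume "x \<in> {0<..}" "y \<in> {0<..}" "x \<le> y"
      then have "nat \<lfloor>max 1 t * x\<rfloor> \<le> nat \<lfloor>max 1 t * y\<rfloor>"
        by (intro nat_mono floor_mono mult_left_mono) auto
      from mult_right_mono[OF monoD[OF monoE this], of "D (nat \<lfloor>t\<rfloor>)"]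
      show "\<sigma> * H t x \<le> \<sigma> * H t y"
        using D0[of "nat \<lfloor>t\<rfloor>"] by (simp add: H_def mult.assoc)
    qed
    show "mono_on {0<..} (\<lambda>x. \<sigma> * (x powr - \<rho> / K))"
    proof (rule mono_onI)
      fix x y :: real assume xy: "x \<in> {0<..}" "y \<in> {0<..}" "x \<le> y"
      have "\<sigma> * x powr - \<rho> \<le> \<sigma> * y powr - \<rho>"
      proof (cases "0 < \<sigma>")
        case True
        then have "\<rho> \<le> 0" using \<sigma> by (simp add: mult_le_0_iff)
        then show ?thesis using True xy by (intro mult_left_mono powr_mono2) auto
      next
        case False
        then have "\<sigma> < 0" "0 \<le> \<rho>" using \<sigma> by (auto simp: mult_le_0_iff)
        then show ?thesis using xy by (intro mult_left_mono_neg powr_mono2') auto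
      qed
      then show "\<sigma> * (x powr - \<rho> / K) \<le> \<sigma> * (y powr - \<rho> / K)"
        using K by (simp add: divide_right_mono)
    qed
    show "isCont (\<lambda>x. x powr - \<rho> / K) 1" using K by (intro continuous_intros) auto
    show "((\<lambda>t. \<integral>x. exp (- (real (Suc n) * x)) * H t x \<partial>pos_lborel) \<longlongrightarrow>
      (\<integral>x. exp (- (real (Suc n) * x)) * (x powr - \<rho> / K) \<partial>pos_lborel)) at_top" for n
    proof -
      define l where "l = real (Suc n)"
      have l: "0 < l" by (simp add: l_def)
      have fl: "filterlim (\<lambda>t. 1 / l * t) at_top at_top" using l by (intro filterlim_mult_at_top_real) simp
      define a where "a t = step_laplace D (1 / t) / (t * D (nat \<lfloor>t\<rfloor>))" for t
      define p where "p t = step_laplace E (1 / t) * step_laplace D (1 / t) / t\<^sup>2" for t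
      have a: "((\<lambda>t. a (1 / l * t)) \<longlongrightarrow> Gamma (1 + \<rho>)) at_top"
        using filterlim_compose[OF A fl] by (simp add: a_def)
      \<comment> \<open>At \<open>t / l\<close> the quotient \<open>p / a\<close> eliminates the
        transform of \<open>D\<close> and leaves that of \<open>E\<close> at \<open>l / t\<close>,
        times \<open>l * D (nat \<lfloor>t / l\<rfloor>) / t\<close>. The two further divisions turn
        this into the transform of \<open>H t\<close> at \<open>l\<close>.\<close>
      have "((\<lambda>t. p (1 / l * t) / a (1 / l * t) / (D (nat \<lfloor>1 / l * t\<rfloor>) / D (nat \<lfloor>t\<rfloor>)) / l) \<longlongrightarrow>
          1 / Gamma (1 + \<rho>) / (1 / l) powr \<rho> / l) at_top"
      proof (intro tendsto_divide tendsto_const a)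
        show "((\<lambda>t. p (1 / l * t)) \<longlongrightarrow> 1) at_top"
          using filterlim_compose[OF P fl] by (simp add: p_def)
        show "((\<lambda>t. D (nat \<lfloor>1 / l * t\<rfloor>) / D (nat \<lfloor>t\<rfloor>)) \<longlongrightarrow> (1 / l) powr \<rho>) at_top"
          using rv l unfolding step_rv_def by (metis zero_less_divide_1_iff)
      qed (use l G in auto)
      then have "((\<lambda>t. \<integral>x. exp (- (l * x)) * H t x \<partial>pos_lborel) \<longlongrightarrow>
          1 / Gamma (1 + \<rho>) / (1 / l) powr \<rho> / l) at_top"
      proof (rule Lim_transform_eventually)
        \<comment> \<open>Positivity of \<open>a\<close> shows that the transform of
          \<open>D\<close> is nonzero, so that it may be cancelled.\<close>
        have "\<forall>\<^sub>F t in at_top. 0 < a (1 / l * t)" using a G by (intro order_tendstoD) auto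
        then show "\<forall>\<^sub>F t in at_top. p (1 / l * t) / a (1 / l * t)
            / (D (nat \<lfloor>1 / l * t\<rfloor>) / D (nat \<lfloor>t\<rfloor>)) / l = (\<integral>x. exp (- (l * x)) * H t x \<partial>pos_lborel)"
          using eventually_gt_at_top[of 1]
        proof eventually_elim
          case (elim t)
          have "(\<integral>x. exp (- (l * x)) * H t x \<partial>pos_lborel) = D (nat \<lfloor>t\<rfloor>) * (step_laplace E (l / t) / t)"
            unfolding scale using elim step_laplace_scale[of t l E] by (simp add: max_def)
          moreover have "1 / (1 / l * t) = l / t" by simp
          moreover have "step_laplace D (l / t) \<noteq> 0" using elim by (auto simp: a_def)
          ultimately show ?case
            using elim l D0[of "nat \<lfloor>t\<rfloor>"] D0[of "nat \<lfloor>1 / l * t\<rfloor>"] unfolding a_def p_def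
            by (simp add: field_simps power2_eq_square)
        qed
      qed
      moreover have "1 / Gamma (1 + \<rho>) / (1 / l) powr \<rho> / l
          = (\<integral>x. exp (- (l * x)) * (x powr - \<rho> / K) \<partial>pos_lborel)"
      proof -
        have "(\<integral>x. exp (- (l * x)) * (x powr - \<rho> / K) \<partial>pos_lborel) = Gamma (1 - \<rho>) * l powr (\<rho> - 1) / K"
          unfolding GG using laplace_powr(2)[of "- \<rho>" l] \<rho> l by simp
        also have "\<dots> = 1 / Gamma (1 + \<rho>) / (1 / l) powr \<rho> / l"
          using G l by (simp add: K_def powr_diff powr_divide field_simps)
        finally show ?thesis ..
      qed
      ultimately show ?thesis by (simp only: l_def)
    qed
  qed (use \<sigma> in simp)
  then have "((\<lambda>t. H t 1) \<longlongrightarrow> 1 / K) at_top" by simp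
  then show ?thesis
    unfolding K_def
  proof (rule Lim_transform_eventually)
    show "\<forall>\<^sub>F t in at_top. H t 1 = E (nat \<lfloor>t\<rfloor>) * D (nat \<lfloor>t\<rfloor>)"
      using eventually_ge_at_top[of 1] by eventually_elim (simp add: H_def max_def)
  qed
qed

text \<open>With \<open>z = exp (- s)\<close>, the generating function of the convolution
  \<open>c\<close> is the product of those of \<open>u\<close> and \<open>q\<close>, and that of
  \<open>W\<close> is the one of \<open>q\<close> divided by \<open>1 - z\<close>. The factors
  \<open>(1 - z) / s\<close> of the step transforms combine so that the product for \<open>W\<close>
  and \<open>u\<close> is the transform of \<open>c\<close> divided by \<open>s\<close>. Abel's
  theorem for the limit 1 of \<open>c\<close> does the rest.\<close>

lemma renewal_laplace_product:
  fixes u q :: "nat \<Rightarrow> real"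
  assumes u: "\<And>n. 0 \<le> u n" "\<And>n. u n \<le> Ku" and q: "\<And>n. 0 \<le> q n" "\<And>n. q n \<le> Kq"
    and conv: "(\<lambda>n. \<Sum>k\<le>n. u k * q (n - k)) \<longlonglongrightarrow> 1"
  defines "W \<equiv> \<lambda>n. \<Sum>k\<le>n. q k"
  shows "((\<lambda>t. step_laplace W (1 / t) * step_laplace u (1 / t) / t\<^sup>2) \<longlongrightarrow> 1) at_top"
    and "\<And>s. 0 < s \<Longrightarrow> integrable pos_lborel (\<lambda>x. exp (- (s * x)) * u (nat \<lfloor>x\<rfloor>))"
    and "\<And>s. 0 < s \<Longrightarrow> integrable pos_lborel (\<lambda>x. exp (- (s * x)) * W (nat \<lfloor>x\<rfloor>))"
proof -
  define c where "c n = (\<Sum>k\<le>n. u k * q (n - k))" for n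
  have c0: "0 \<le> c n" for n using u q by (auto simp: c_def intro!: sum_nonneg)
  have W0: "0 \<le> W n" for n using q by (auto simp: W_def intro!: sum_nonneg)
  have "Bseq c" using conv by (intro convergent_imp_Bseq convergentI) (simp add: c_def[abs_def])
  then obtain Kc where "\<And>n. norm (c n) \<le> Kc" by (elim BseqE) blast
  then have Kc: "c n \<le> Kc" for n by (metis real_norm_def abs_le_D1)
  define z where "z s = exp (- s)" for s :: real
  have z: "0 \<le> z s" "z s < 1" if "0 < s" for s using that by (auto simp: z_def)
  have su: "summable (\<lambda>k. u k * z s ^ k)" and sq: "summable (\<lambda>k. q k * z s ^ k)"
    and sc: "summable (\<lambda>k. c k * z s ^ k)" if "0 < s" for s
    using summable_bounded_mult_power[OF u z[OF that]] summable_bounded_mult_power[OF q z[OF that]]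
      summable_bounded_mult_power[OF c0 Kc z[OF that]] by auto
  have sW: "(\<lambda>k. W k * z s ^ k) sums ((\<Sum>k. q k * z s ^ k) * (1 / (1 - z s)))" if "0 < s" for s
  proof -
    have "(\<lambda>k. \<Sum>i\<le>k. (q i * z s ^ i) * z s ^ (k - i)) sums ((\<Sum>k. q k * z s ^ k) * (\<Sum>k. z s ^ k))"
      using sq[OF that] q z[OF that]
      by (intro Cauchy_product_sums) (auto simp: abs_mult summable_geometric)
    moreover have "(\<Sum>i\<le>k. (q i * z s ^ i) * z s ^ (k - i)) = W k * z s ^ k" for k
      unfolding W_def sum_distrib_right
      by (intro sum.cong refl) (simp add: mult.assoc power_add[symmetric])
    ultimately show ?thesis using z[OF that] by (simp add: suminf_geometric)
  qed
  have cp: "(\<Sum>k. u k * z s ^ k) * (\<Sum>k. q k * z s ^ k) = (\<Sum>k. c k * z s ^ k)" if "0 < s" for s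
  proof -
    have "(\<Sum>k. u k * z s ^ k) * (\<Sum>k. q k * z s ^ k)
        = (\<Sum>k. \<Sum>i\<le>k. (u i * z s ^ i) * (q (k - i) * z s ^ (k - i)))"
      using su[OF that] sq[OF that] u q z[OF that] by (intro Cauchy_product) (auto simp: abs_mult)
    moreover have "(\<Sum>i\<le>k. (u i * z s ^ i) * (q (k - i) * z s ^ (k - i))) = c k * z s ^ k" for k
      unfolding c_def sum_distrib_right
    proof (intro sum.cong refl)
      fix i assume "i \<in> {..k}"
      then have "z s ^ k = z s ^ i * z s ^ (k - i)" by (simp add: power_add[symmetric])
      then show "(u i * z s ^ i) * (q (k - i) * z s ^ (k - i)) = u i * q (k - i) * z s ^ k"
        by (simp only: mult.assoc mult.left_commute)
    qed
    ultimately show ?thesis by (simp only:)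
  qed
  note lu = step_laplace_series[OF u(1) _ su[unfolded z_def]]
  note lW = step_laplace_series[OF W0 _ sums_summable[OF sW, unfolded z_def]]
  note lc = step_laplace_series[OF c0 _ sc[unfolded z_def]]
  show "integrable pos_lborel (\<lambda>x. exp (- (s * x)) * u (nat \<lfloor>x\<rfloor>))"
    "integrable pos_lborel (\<lambda>x. exp (- (s * x)) * W (nat \<lfloor>x\<rfloor>))" if "0 < s" for s
    using lu(1) lW(1) that by auto
  have prod: "step_laplace W s * step_laplace u s * s\<^sup>2 = s * step_laplace c s" if s: "0 < s" for s
  proof -
    have "(1 - z s) * (\<Sum>k. W k * z s ^ k) = (\<Sum>k. q k * z s ^ k)"
      unfolding sums_unique[OF sW[OF s], symmetric] using z[OF s] by simp
    then have "(1 - z s) * (\<Sum>k. W k * z s ^ k) * (\<Sum>k. u k * z s ^ k) = (\<Sum>k. c k * z s ^ k)"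
      unfolding cp[OF s, symmetric] by (simp only: mult.commute)
    then have "(1 - z s) * ((1 - z s) * (\<Sum>k. W k * z s ^ k) * (\<Sum>k. u k * z s ^ k))
        = (1 - z s) * (\<Sum>k. c k * z s ^ k)" by (simp only:)
    then show ?thesis
      unfolding lu(2)[OF s s] lW(2)[OF s s] lc(2)[OF s s] z_def[symmetric]
      using s by (simp add: power2_eq_square mult.assoc mult.left_commute)
  qed
  \<comment> \<open>Abel's theorem as the case of exponent 0 and normalisation 1; boundedness of
    \<open>c\<close> provides the majorant.\<close>
  have "((\<lambda>t. 1 * step_laplace c (1 / t) / t) \<longlongrightarrow> Gamma (1 + 0)) at_top"
  proof (rule abelian_step_laplace[where a = 0])
    fix y :: real assume y: "0 < y"
    have "filterlim (\<lambda>t. nat \<lfloor>t / (1 / y)\<rfloor>) sequentially at_top"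
      using y by (intro filterlim_nat_floor_divide) simp
    from filterlim_compose[OF conv this]
    show "((\<lambda>t. 1 * c (nat \<lfloor>t * y\<rfloor>)) \<longlongrightarrow> y powr 0) at_top" using y by (simp add: c_def)
  next
    show "integrable pos_lborel (\<lambda>y. Kc * (exp (- (1 * y)) * y powr 0))"
      by (intro integrable_mult_right laplace_powr) auto
    fix t y :: real assume "0 < y"
    then show "exp (- y) * \<bar>1 * c (nat \<lfloor>t * y\<rfloor>)\<bar> \<le> Kc * (exp (- (1 * y)) * y powr 0)"
      using Kc c0 by simp
  qed simp
  then have "((\<lambda>t. step_laplace c (1 / t) / t) \<longlongrightarrow> 1) at_top" by simp
  then show "((\<lambda>t. step_laplace W (1 / t) * step_laplace u (1 / t) / t\<^sup>2) \<longlongrightarrow> 1) at_top"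
  proof (rule Lim_transform_eventually)
    show "\<forall>\<^sub>F t in at_top. step_laplace c (1 / t) / t
        = step_laplace W (1 / t) * step_laplace u (1 / t) / t\<^sup>2"
      using eventually_gt_at_top[of 0]
    proof eventually_elim
      case (elim t)
      then show ?case using prod[of "1 / t"] by (simp add: field_simps power2_eq_square)
    qed
  qed
qed

text \<open>The disjunctive hypothesis lets both directions lead to the same limit of
  \<open>W / b\<close>. That limit then returns regular variation of whichever sequence was not
  assumed to have it.\<close>

theorem renewal_regular_variation:
  fixes b q :: "nat \<Rightarrow> real" and \<beta> :: real
  assumes inc: "incseq b" and b: "\<And>n. 0 < b n"
    and q: "\<And>n. 0 \<le> q n" "\<And>n. q n \<le> K" and q0: "0 < q 0"
    and conv: "(\<lambda>n. \<Sum>k\<le>n. q (n - k) / b k) \<longlonglongrightarrow> 1"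
    and \<beta>: "0 \<le> \<beta>" "\<beta> < 1"
  defines "W \<equiv> \<lambda>n. \<Sum>k\<le>n. q k"
  assumes rv: "regularly_varying_seq b \<beta> \<or> regularly_varying_seq W \<beta>"
  shows "regularly_varying_seq b \<beta>" "regularly_varying_seq W \<beta>"
    and "(\<lambda>n. W n / b n) \<longlonglongrightarrow> 1 / (Gamma (1 + \<beta>) * Gamma (1 - \<beta>))"
proof -
  define u where "u n = 1 / b n" for n
  have u: "0 < u n" "u n \<le> 1 / b 0" for n
    using b[of n] b[of 0] incseqD[OF inc, of 0 n] by (auto simp: u_def intro!: divide_left_mono)
  have W0: "0 < W n" for n
    unfolding W_def by (rule sum_pos2[where i = 0]) (use q q0 in auto)
  have incW: "incseq W" unfolding W_def by (intro incseq_SucI) (simp add: q)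
  have conv': "(\<lambda>n. \<Sum>k\<le>n. u k * q (n - k)) \<longlonglongrightarrow> 1" using conv by (simp add: u_def)
  note lap = renewal_laplace_product[OF less_imp_le[OF u(1)] u(2) q conv', folded W_def]
  have G: "0 < Gamma (1 + \<beta>)" "0 < Gamma (1 - \<beta>)" using \<beta> by (auto intro!: Gamma_real_pos)
  have rv': "step_rv b \<beta> \<or> step_rv W \<beta>"
    using rv regularly_varying_seq_imp_step_rv[OF _ inc b]
      regularly_varying_seq_imp_step_rv[OF _ incW W0] by auto
  have lim: "((\<lambda>t::real. W (nat \<lfloor>t\<rfloor>) / b (nat \<lfloor>t\<rfloor>)) \<longlongrightarrow> 1 / (Gamma (1 + \<beta>) * Gamma (1 - \<beta>))) at_top"
    using rv'
  proof
    assume s: "step_rv b \<beta>"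
    have "((\<lambda>t::real. W (nat \<lfloor>t\<rfloor>) * u (nat \<lfloor>t\<rfloor>)) \<longlongrightarrow> 1 / (Gamma (1 + - \<beta>) * Gamma (1 - - \<beta>))) at_top"
    \<comment> \<open>Known side: \<open>u = 1 / b\<close> with exponent -\<beta>. The Tauberian
      conclusion is drawn for the increasing \<open>W\<close>.\<close>
    proof (rule tauberian_transfer[where \<sigma> = 1])
      show "step_rv u (- \<beta>)" using step_rv_inverse[OF s] by (simp add: u_def[abs_def])
      show "((\<lambda>t. step_laplace u (1 / t) / (t * u (nat \<lfloor>t\<rfloor>))) \<longlongrightarrow> Gamma (1 + - \<beta>)) at_top"
        using abelian_inverse_increasing[OF s inc b \<beta>] by (simp add: u_def[abs_def])
      show "integrable pos_lborel (\<lambda>x. exp (- (s * x)) * W (nat \<lfloor>x\<rfloor>))" if "0 < s" for s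
        unfolding W_def by (rule lap(3)[OF that])
      show "mono (\<lambda>n. 1 * W n)" using incW by simp
    qed (use \<beta> u W0[THEN less_imp_le] lap(1) in simp_all)
    then show ?thesis by (simp add: u_def mult.commute)
  next
    assume s: "step_rv W \<beta>"
    have "((\<lambda>t::real. u (nat \<lfloor>t\<rfloor>) * W (nat \<lfloor>t\<rfloor>)) \<longlongrightarrow> 1 / (Gamma (1 + \<beta>) * Gamma (1 - \<beta>))) at_top"
    \<comment> \<open>Known side: \<open>W\<close> with exponent \<beta>. The Tauberian conclusion
      is drawn for the decreasing \<open>u\<close>.\<close>
    proof (rule tauberian_transfer[where \<sigma> = "- 1"])
      show "mono (\<lambda>n. - 1 * u n)"
        using b incseqD[OF inc] by (auto intro!: monoI divide_left_mono mult_pos_pos simp: u_def)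
      show "((\<lambda>t. step_laplace W (1 / t) / (t * W (nat \<lfloor>t\<rfloor>))) \<longlongrightarrow> Gamma (1 + \<beta>)) at_top"
        by (rule abelian_increasing[OF s incW W0 \<beta>(1)])
      show "((\<lambda>t. step_laplace u (1 / t) * step_laplace W (1 / t) / t\<^sup>2) \<longlongrightarrow> 1) at_top"
        using lap(1) by (simp add: mult.commute)
      show "integrable pos_lborel (\<lambda>x. exp (- (s * x)) * u (nat \<lfloor>x\<rfloor>))" if "0 < s" for s
        by (rule lap(2)[OF that])
    qed (use \<beta> u(1)[THEN less_imp_le] W0 s in simp_all)
    then show ?thesis by (simp add: u_def mult.commute)
  qed
  have "((\<lambda>t::real. inverse (W (nat \<lfloor>t\<rfloor>) / b (nat \<lfloor>t\<rfloor>))) \<longlongrightarrow>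
      inverse (1 / (Gamma (1 + \<beta>) * Gamma (1 - \<beta>)))) at_top"
    using G by (intro tendsto_inverse lim) auto
  then have lim': "((\<lambda>t::real. b (nat \<lfloor>t\<rfloor>) / W (nat \<lfloor>t\<rfloor>)) \<longlongrightarrow> Gamma (1 + \<beta>) * Gamma (1 - \<beta>)) at_top"
    by (simp add: divide_inverse mult.commute)
  show "regularly_varying_seq b \<beta>"
    using rv' step_rv_tendsto_ratio[OF _ W0 _ lim'] G b
    by (intro step_rv_imp_regularly_varying_seq) auto
  show "regularly_varying_seq W \<beta>"
    using rv' step_rv_tendsto_ratio[OF _ b _ lim] G W0
    by (intro step_rv_imp_regularly_varying_seq) auto
  show "(\<lambda>n. W n / b n) \<longlonglongrightarrow> 1 / (Gamma (1 + \<beta>) * Gamma (1 - \<beta>))"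
    using filterlim_compose[OF lim filterlim_real_sequentially] by simp
qed

section \<open>The renewal relation of a uniformly returning set\<close>

text \<open>For large \<open>k\<close> the relative error sums to at most \<epsilon> times the
  convolution itself. The finitely many remaining \<open>k\<close> contribute terms that vanish one
  by one, since \<open>n - k\<close> tends to infinity. The estimate is self-referential, so
  boundedness of the convolution has to be extracted from it first.\<close>

lemma perturbed_convolution_tendsto:
  fixes b q :: "nat \<Rightarrow> real" and v :: "nat \<Rightarrow> nat \<Rightarrow> real"
  assumes b: "\<And>n. 0 < b n" and q: "\<And>n. 0 \<le> q n" "q \<longlonglongrightarrow> 0"
    and v: "\<And>k. v k \<longlonglongrightarrow> 0" and lim: "(\<lambda>n. \<Sum>k\<le>n. v k (n - k)) \<longlonglongrightarrow> 1"
    and unif: "\<And>\<epsilon>. 0 < \<epsilon> \<Longrightarrow> \<forall>\<^sub>F k in sequentially. \<forall>j. \<bar>b k * v k j - q j\<bar> \<le> \<epsilon> * q j"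
  shows "(\<lambda>n. \<Sum>k\<le>n. q (n - k) / b k) \<longlonglongrightarrow> 1"
proof -
  define c where "c n = (\<Sum>k\<le>n. q (n - k) / b k)" for n
  define d where "d n = (\<Sum>k\<le>n. v k (n - k))" for n
  have c0: "0 \<le> c n" for n unfolding c_def using b q by (intro sum_nonneg divide_nonneg_pos) auto
  have "(\<lambda>n. d n - c n) \<longlonglongrightarrow> 0"
  proof (rule LIMSEQ_I)
    fix r :: real assume r: "0 < r"
    \<comment> \<open>The bound 1/2 allows absorption: eventually
      \<open>c n \<le> 3 / 2 + 1 / 2 + c n / 2\<close>, hence \<open>c n \<le> 4\<close>. The bound
      \<open>r / 8\<close> then makes \<open>\<epsilon> * c n\<close> at most
      \<open>r / 2\<close>.\<close>
    define \<epsilon> where "\<epsilon> = min (1 / 2) (r / 8)"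
    have \<epsilon>: "0 < \<epsilon>" "\<epsilon> \<le> 1 / 2" "4 * \<epsilon> \<le> r / 2" using r by (auto simp: \<epsilon>_def)
    from unif[OF \<epsilon>(1)] obtain N where
      N: "\<And>k j. N \<le> k \<Longrightarrow> \<bar>b k * v k j - q j\<bar> \<le> \<epsilon> * q j"
      by (auto simp: eventually_sequentially)
    define e where "e n = (\<Sum>k<N. \<bar>v k (n - k) - q (n - k) / b k\<bar>)" for n
    have "e \<longlonglongrightarrow> (\<Sum>k<N. \<bar>0 - 0 / b k\<bar>)"
      unfolding e_def
      by (intro tendsto_intros filterlim_compose[OF v] filterlim_compose[OF q(2)]
          filterlim_minus_const_nat_at_top) (use b in \<open>auto simp: less_imp_neq[symmetric]\<close>)
    then have e: "e \<longlonglongrightarrow> 0" by simp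
    have tail: "\<bar>v k j - q j / b k\<bar> \<le> \<epsilon> * (q j / b k)" if "N \<le> k" for k j
    proof -
      have "v k j - q j / b k = (b k * v k j - q j) / b k" using b[of k] by (simp add: field_simps)
      then have "\<bar>v k j - q j / b k\<bar> = \<bar>b k * v k j - q j\<bar> / b k" using b[of k] by simp
      also have "\<dots> \<le> \<epsilon> * q j / b k" using N[OF that] b[of k] by (intro divide_right_mono) auto
      finally show ?thesis by simp
    qed
    have diff: "\<bar>d n - c n\<bar> \<le> e n + \<epsilon> * c n" if n: "N \<le> n" for n
    proof -
      have split: "{..n} = {..<N} \<union> {N..n}" using n by auto
      have "\<bar>d n - c n\<bar> \<le> (\<Sum>k\<le>n. \<bar>v k (n - k) - q (n - k) / b k\<bar>)"
        unfolding d_def c_def sum_subtractf[symmetric] by (rule sum_abs)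
      also have "\<dots> = e n + (\<Sum>k\<in>{N..n}. \<bar>v k (n - k) - q (n - k) / b k\<bar>)"
        unfolding split e_def by (intro sum.union_disjoint) auto
      also have "(\<Sum>k\<in>{N..n}. \<bar>v k (n - k) - q (n - k) / b k\<bar>) \<le> (\<Sum>k\<in>{N..n}. \<epsilon> * (q (n - k) / b k))"
        by (intro sum_mono tail) auto
      also have "\<dots> \<le> (\<Sum>k\<le>n. \<epsilon> * (q (n - k) / b k))"
        using q \<epsilon> b by (intro sum_mono2) (auto intro!: mult_nonneg_nonneg divide_nonneg_pos)
      also have "\<dots> = \<epsilon> * c n" by (simp add: c_def sum_distrib_left)
      finally show ?thesis by simp
    qed
    have "\<forall>\<^sub>F n in sequentially. e n < min (1 / 2) (r / 2)"
      using e r by (intro order_tendstoD(2)) auto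
    moreover have "\<forall>\<^sub>F n in sequentially. d n < 3 / 2"
      using lim by (intro order_tendstoD(2)) (auto simp: d_def[abs_def])
    ultimately have "\<forall>\<^sub>F n in sequentially. norm (d n - c n - 0) < r"
      using eventually_ge_at_top[of N]
    proof eventually_elim
      case (elim n)
      have "\<epsilon> * c n \<le> 1 / 2 * c n" using \<epsilon> c0[of n] by (intro mult_right_mono) auto
      then have "c n \<le> 4" using diff[OF elim(3)] elim by linarith
      then have "\<epsilon> * c n \<le> \<epsilon> * 4" using \<epsilon> by (intro mult_left_mono) auto
      then show ?case using diff[OF elim(3)] elim(1) \<epsilon>(3) by simp
    qed
    then show "\<exists>no. \<forall>n\<ge>no. norm (d n - c n - 0) < r" by (simp add: eventually_sequentially)
  qed
  from tendsto_diff[OF lim[folded d_def] this] show ?thesis by (simp add: c_def)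
qed

section \<open>Preimages and iterated transfer in a measure preserving system\<close>

locale measure_preserving_system = sigma_finite_measure M for M :: "'a measure" +
  fixes T :: "'a \<Rightarrow> 'a"
  assumes mp: "measure_preserving M T"
begin

definition pre :: "nat \<Rightarrow> 'a set \<Rightarrow> 'a set" where
  "pre k B = (T ^^ k) -` B \<inter> space M"

lemma T_measurable [measurable]: "T \<in> measurable M M"
  using mp by (simp add: measure_preserving_def)

lemma T_pow_space: "x \<in> space M \<Longrightarrow> (T ^^ k) x \<in> space M"
  by (rule measurable_space[OF measurable_compose_n[OF T_measurable]])

lemma pre_sets [measurable]: "B \<in> sets M \<Longrightarrow> pre k B \<in> sets M"
  unfolding pre_def by (rule measurable_sets[OF measurable_compose_n[OF T_measurable]])

lemma pre_0: "B \<in> sets M \<Longrightarrow> pre 0 B = B"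
  using sets.sets_into_space by (auto simp: pre_def)

lemma pre_Suc: "pre (Suc k) B = pre k (T -` B \<inter> space M)"
  using T_pow_space by (auto simp: pre_def)

lemma emeasure_pre: "B \<in> sets M \<Longrightarrow> emeasure M (pre k B) = emeasure M B"
proof (induction k arbitrary: B)
  case (Suc k)
  then have "T -` B \<inter> space M \<in> sets M" by measurable
  from Suc.IH[OF this] show ?case
    using Suc.prems mp by (simp add: pre_Suc measure_preserving_def)
qed (simp add: pre_0)

text \<open>Every application of \<open>transfer_op\<close> picks some version, but its
  characterization involves only integrals over sets and hence iterates: pulling \<open>B\<close>
  back once more turns \<open>pre k\<close> into \<open>pre (Suc k)\<close>.\<close>

lemma transfer_op_pow:
  assumes "integrable M f"
  shows "integrable M ((transfer_op M T ^^ k) f) \<and>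
    (\<forall>B\<in>sets M. (LINT x:B|M. (transfer_op M T ^^ k) f x) = (LINT x:pre k B|M. f x))"
proof (induction k)
  case (Suc k)
  have "is_transfer M T ((transfer_op M T ^^ k) f) ((transfer_op M T ^^ Suc k) f)"
    using is_transfer_transfer_op[OF sigma_finite_measure_axioms mp] Suc by simp
  then show ?case using Suc by (auto simp: is_transfer_def pre_Suc)
qed (use assms in \<open>auto simp: pre_0\<close>)

section \<open>The last visit to a set\<close>

definition unreturned :: "'a set \<Rightarrow> nat \<Rightarrow> 'a set" where
  "unreturned A j = A - (\<Union>i\<in>{1..j}. pre i A)"

lemma unreturned_sets [measurable]: "A \<in> sets M \<Longrightarrow> unreturned A j \<in> sets M"
  by (auto simp: unreturned_def intro!: sets.Diff sets.finite_UN)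

lemma set_integrable_of_integrable:
  fixes g :: "'a \<Rightarrow> real"
  shows "integrable M g \<Longrightarrow> B \<in> sets M \<Longrightarrow> set_integrable M B g"
  unfolding set_integrable_def by (rule integrable_mult_indicator)

text \<open>For \<open>j = n - k\<close> the right-hand side says that \<open>k\<close> is the last
  visit to \<open>A\<close> up to time \<open>n\<close>. A point has at most one such
  \<open>k\<close>.\<close>

lemma in_pre_unreturned:
  "x \<in> pre k (unreturned A j) \<longleftrightarrow>
    x \<in> space M \<and> (T ^^ k) x \<in> A \<and> (\<forall>i. k < i \<and> i \<le> k + j \<longrightarrow> (T ^^ i) x \<notin> A)"
proof -
  have "(\<forall>i\<in>{1..j}. (T ^^ i) ((T ^^ k) x) \<notin> A) \<longleftrightarrow> (\<forall>i. k < i \<and> i \<le> k + j \<longrightarrow> (T ^^ i) x \<notin> A)"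
  proof (intro iffI ballI allI impI)
    fix i assume *: "\<forall>i\<in>{1..j}. (T ^^ i) ((T ^^ k) x) \<notin> A" "k < i \<and> i \<le> k + j"
    then have "i - k \<in> {1..j}" by auto
    with *(1) have "(T ^^ (i - k)) ((T ^^ k) x) \<notin> A" by blast
    moreover have "(T ^^ (i - k)) ((T ^^ k) x) = (T ^^ (i - k + k)) x" by (simp only: funpow_add o_apply)
    ultimately show "(T ^^ i) x \<notin> A" using * by simp
  next
    fix i assume *: "\<forall>i. k < i \<and> i \<le> k + j \<longrightarrow> (T ^^ i) x \<notin> A" "i \<in> {1..j}"
    then have "(T ^^ (i + k)) x \<notin> A" by auto
    then show "(T ^^ i) ((T ^^ k) x) \<notin> A" by (simp add: funpow_add)
  qed
  then show ?thesis by (auto simp: pre_def unreturned_def T_pow_space)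
qed

lemma last_visit_decomposition:
  shows "(\<Union>k\<le>n. pre k A) = (\<Union>k\<in>{..n}. pre k (unreturned A (n - k)))"
    and "disjoint_family_on (\<lambda>k. pre k (unreturned A (n - k))) {..n}"
proof -
  show "(\<Union>k\<le>n. pre k A) = (\<Union>k\<in>{..n}. pre k (unreturned A (n - k)))"
  proof (intro equalityI subsetI)
    fix x assume "x \<in> (\<Union>k\<le>n. pre k A)"
    then have x: "x \<in> space M" and ne: "{k. k \<le> n \<and> (T ^^ k) x \<in> A} \<noteq> {}" by (auto simp: pre_def)
    have fin: "finite {k. k \<le> n \<and> (T ^^ k) x \<in> A}" by simp
    define k where "k = Max {k. k \<le> n \<and> (T ^^ k) x \<in> A}"
    have k: "k \<le> n" "(T ^^ k) x \<in> A" using Max_in[OF fin ne] by (auto simp: k_def)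
    have "i \<le> k" if "(T ^^ i) x \<in> A" "i \<le> n" for i
      unfolding k_def using that by (intro Max_ge fin) simp
    then have "(T ^^ i) x \<notin> A" if "k < i" "i \<le> n" for i
      using that by (metis not_le)
    then show "x \<in> (\<Union>k\<in>{..n}. pre k (unreturned A (n - k)))"
      using x k by (auto simp: in_pre_unreturned intro!: bexI[of _ k])
  qed (auto simp: unreturned_def pre_def)
  show "disjoint_family_on (\<lambda>k. pre k (unreturned A (n - k))) {..n}"
    unfolding disjoint_family_on_def
  proof (intro ballI impI equals0I)
    fix k l x
    assume "k \<in> {..n}" "l \<in> {..n}" "k \<noteq> l"
      "x \<in> pre k (unreturned A (n - k)) \<inter> pre l (unreturned A (n - l))"
    then show False by (cases "k < l") (auto simp: in_pre_unreturned)
  qed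
qed

lemma wandering_rate_conv_sum:
  assumes A: "A \<in> sets M" "emeasure M A < \<infinity>"
  shows "wandering_rate M T A n = (\<Sum>j\<le>n. measure M (unreturned A j))"
proof -
  have "emeasure M (unreturned A j) \<noteq> \<infinity>" for j
    using emeasure_mono[of "unreturned A j" A M] A by (auto simp: unreturned_def top_unique)
  then have "wandering_rate M T A n = (\<Sum>k\<le>n. measure M (pre k (unreturned A (n - k))))"
    unfolding wandering_rate_def pre_def[symmetric] last_visit_decomposition(1)
    using A by (intro measure_finite_Union last_visit_decomposition) (auto simp: emeasure_pre)
  also have "\<dots> = (\<Sum>k\<le>n. measure M (unreturned A (n - k)))"
    using A by (simp add: measure_def emeasure_pre)
  also have "\<dots> = (\<Sum>j\<le>n. measure M (unreturned A j))"
    by (rule sum.reindex_bij_witness[of _ "\<lambda>k. n - k" "\<lambda>k. n - k"]) auto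
  finally show ?thesis .
qed

text \<open>Duality moves the integral over the piece of index \<open>k\<close> to a subset of
  \<open>A\<close>, where uniform return describes the iterate.\<close>

lemma last_visit_integral:
  assumes A: "A \<in> sets M" and f: "integrable M f"
  shows "(\<Sum>k\<le>n. LINT x:unreturned A (n - k)|M. (transfer_op M T ^^ k) f x)
    = (LINT x:(\<Union>k\<le>n. pre k A)|M. f x)"
proof -
  have "(LINT x:(\<Union>k\<le>n. pre k A)|M. f x) = (\<Sum>k\<le>n. LINT x:pre k (unreturned A (n - k))|M. f x)"
    unfolding last_visit_decomposition(1) using A f
    by (intro set_integral_finite_Union last_visit_decomposition set_integrable_of_integrable) auto
  then show ?thesis using transfer_op_pow[OF f] A by simp
qed

lemma decseq_unreturned: "decseq (unreturned A)"
  unfolding decseq_def unreturned_def by fastforce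

text \<open>A point lies in the preimage of index \<open>k\<close> exactly when \<open>k\<close> is
  its last visit of all. Such a \<open>k\<close> is unique, so the set is wandering and
  conservativity applies.\<close>

lemma never_return_null:
  assumes c: "conservative_map M T" and A: "A \<in> sets M"
  shows "(\<Inter>j. unreturned A j) \<in> null_sets M"
proof -
  have in_pre: "x \<in> pre k (\<Inter>j. unreturned A j) \<longleftrightarrow>
      x \<in> space M \<and> (T ^^ k) x \<in> A \<and> (\<forall>i>k. (T ^^ i) x \<notin> A)" for x k
  proof -
    have "x \<in> pre k (\<Inter>j. unreturned A j) \<longleftrightarrow> (\<forall>j. x \<in> pre k (unreturned A j))"
      by (auto simp: pre_def)
    also have "\<dots> \<longleftrightarrow> x \<in> space M \<and> (T ^^ k) x \<in> A \<and> (\<forall>i>k. (T ^^ i) x \<notin> A)"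
      unfolding in_pre_unreturned by (metis le_add_diff_inverse less_or_eq_imp_le order_refl)
    finally show ?thesis .
  qed
  have m: "(\<Inter>j. unreturned A j) \<in> sets M" using A by measurable
  have "disjoint_family (\<lambda>n. pre n (\<Inter>j. unreturned A j))"
    unfolding disjoint_family_on_def
  proof (intro ballI impI equals0I)
    fix k l x
    assume "k \<noteq> l" "x \<in> pre k (\<Inter>j. unreturned A j) \<inter> pre l (\<Inter>j. unreturned A j)"
    then show False by (cases "k < l") (auto simp: in_pre)
  qed
  then have "wandering_set M T (\<Inter>j. unreturned A j)"
    using m by (simp add: wandering_set_def pre_def)
  then show ?thesis using c m by (auto simp: conservative_map_def)
qed

text \<open>By conservativity almost every point of \<open>A\<close> visits \<open>A\<close>
  infinitely often, so the set of all such points is not null; being invariant, it has full measure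
  by ergodicity.\<close>

lemma AE_visits:
  assumes c: "conservative_map M T" and e: "ergodic_map M T"
    and A: "A \<in> sets M" "0 < emeasure M A"
  shows "AE x in M. \<exists>k. x \<in> pre k A"
proof -
  \<comment> \<open>Infinitely many visits rather than at least one: ergodicity is stated for sets
    that equal their preimage, and the points with some visit need not form such a set.\<close>
  define R where "R = (\<Inter>n. \<Union>k\<in>{n..}. pre k A)"
  have [measurable]: "R \<in> sets M" unfolding R_def using A by measurable
  have R: "x \<in> R \<longleftrightarrow> x \<in> space M \<and> (\<forall>n. \<exists>k\<ge>n. (T ^^ k) x \<in> A)" for x
    by (auto simp: R_def pre_def)
  have "T -` R \<inter> space M = R"
  proof (intro equalityI subsetI)
    fix x assume "x \<in> T -` R \<inter> space M"
    then have x: "x \<in> space M" "\<And>n. \<exists>k\<ge>n. (T ^^ k) (T x) \<in> A" by (auto simp: R)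
    have "\<exists>k\<ge>n. (T ^^ k) x \<in> A" for n
      using x(2)[of n] by (metis funpow_swap1 funpow.simps(2) comp_apply le_SucI)
    then show "x \<in> R" using x by (simp add: R)
  next
    fix x assume "x \<in> R"
    then have x: "x \<in> space M" "\<And>n. \<exists>k\<ge>n. (T ^^ k) x \<in> A" by (auto simp: R)
    have "\<exists>k\<ge>n. (T ^^ k) (T x) \<in> A" for n
    proof -
      obtain k where k: "Suc n \<le> k" "(T ^^ k) x \<in> A" using x(2) by blast
      then obtain l where "k = Suc l" by (cases k) auto
      then show ?thesis using k by (intro exI[of _ l]) (simp add: funpow_swap1)
    qed
    then show "x \<in> T -` R \<inter> space M" using x measurable_space[OF T_measurable] by (simp add: R)
  qed
  then have dich: "emeasure M R = 0 \<or> emeasure M (space M - R) = 0"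
    using e by (simp add: ergodic_map_def)
  \<comment> \<open>A point of \<open>A\<close> with only finitely many visits has a last one, and
    at that time it is in the set of points that never return.\<close>
  have "A - R \<subseteq> (\<Union>k. pre k (\<Inter>j. unreturned A j))"
  proof
    fix x assume x: "x \<in> A - R"
    then have xs: "x \<in> space M" using A sets.sets_into_space by auto
    then obtain n where n: "\<And>k. n \<le> k \<Longrightarrow> (T ^^ k) x \<notin> A" using x by (auto simp: R)
    define k where "k = Max {k. (T ^^ k) x \<in> A}"
    have fin: "finite {k. (T ^^ k) x \<in> A}"
      by (rule finite_subset[of _ "{..n}"]) (use n in \<open>auto simp: not_le intro: ccontr\<close>)
    have "0 \<in> {k. (T ^^ k) x \<in> A}" using x by simp
    then have "k \<in> {k. (T ^^ k) x \<in> A}" unfolding k_def by (intro Max_in fin) blast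
    then have "(T ^^ k) x \<in> A" by simp
    moreover have "i \<le> k" if "(T ^^ i) x \<in> A" for i
      unfolding k_def using that by (intro Max_ge fin) simp
    then have "(T ^^ i) x \<notin> A" if "k < i" for i
      using that by (metis not_le)
    ultimately have "x \<in> pre k (unreturned A j)" for j using xs by (simp add: in_pre_unreturned)
    then show "x \<in> (\<Union>k. pre k (\<Inter>j. unreturned A j))" by (auto simp: pre_def)
  qed
  moreover have "(\<Union>k. pre k (\<Inter>j. unreturned A j)) \<in> null_sets M"
    using never_return_null[OF c A(1)] by (intro null_sets_UN) (auto simp: null_sets_def emeasure_pre)
  ultimately have "A - R \<in> null_sets M" using A by (meson null_sets_subset sets.Diff \<open>R \<in> sets M\<close>)
  then have "emeasure M (R \<union> (A - R)) = emeasure M R" by (intro emeasure_Un_null_set) auto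
  moreover have "emeasure M A \<le> emeasure M (R \<union> (A - R))" using A by (intro emeasure_mono) auto
  ultimately have "emeasure M R \<noteq> 0" using A by auto
  then have "space M - R \<in> null_sets M" using dich by auto
  then have "AE x in M. x \<notin> space M - R" by (rule AE_not_in)
  then show ?thesis
    by (rule AE_mp[OF _ AE_I2]) (auto simp: R_def)
qed

text \<open>The sets of points that visit \<open>A\<close> by time \<open>n\<close> increase to
  almost the whole space, so the sums recover the full integral of \<open>f\<close>.\<close>

lemma last_visit_integral_tendsto:
  assumes "conservative_map M T" "ergodic_map M T"
    and A: "A \<in> sets M" "0 < emeasure M A" and f: "integrable M f"
  shows "(\<lambda>n. \<Sum>k\<le>n. LINT x:unreturned A (n - k)|M. (transfer_op M T ^^ k) f x)
    \<longlonglongrightarrow> integral\<^sup>L M f"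
proof -
  have "(\<lambda>n. LINT x:(\<Union>k\<le>n. pre k A)|M. f x) \<longlonglongrightarrow> (LINT x:(\<Union>n. \<Union>k\<le>n. pre k A)|M. f x)"
    using A f by (intro set_integral_cont_up set_integrable_of_integrable)
      (auto simp: incseq_def intro: order_trans)
  moreover have "(LINT x:(\<Union>n. \<Union>k\<le>n. pre k A)|M. f x) = integral\<^sup>L M f"
    unfolding set_lebesgue_integral_def
  proof (rule integral_cong_AE)
    show "AE x in M. indicat_real (\<Union>n. \<Union>k\<le>n. pre k A) x *\<^sub>R f x = f x"
      using AE_visits[OF assms(1-4)] by eventually_elim (auto simp: indicator_def)
  qed (use A f in measurable)
  ultimately show ?thesis using A f by (simp add: last_visit_integral)
qed

text \<open>Continuity from above towards the null set of points that never return. The version with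
  \<open>g\<close> disposes of the finitely many early iterates in the convolution.\<close>

lemma unreturned_tendsto_0:
  fixes g :: "'a \<Rightarrow> real"
  assumes c: "conservative_map M T" and A: "A \<in> sets M" "emeasure M A < \<infinity>"
  shows "(\<lambda>j. measure M (unreturned A j)) \<longlonglongrightarrow> 0"
    and "integrable M g \<Longrightarrow> (\<lambda>j. LINT x:unreturned A j|M. g x) \<longlonglongrightarrow> 0"
proof -
  have "emeasure M (unreturned A j) \<noteq> \<infinity>" for j
    using emeasure_mono[of "unreturned A j" A M] A by (auto simp: unreturned_def top_unique)
  then have "(\<lambda>j. measure M (unreturned A j)) \<longlonglongrightarrow> measure M (\<Inter>j. unreturned A j)"
    using A decseq_unreturned by (intro Lim_measure_decseq) auto
  then show "(\<lambda>j. measure M (unreturned A j)) \<longlonglongrightarrow> 0"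
    using never_return_null[OF c A(1)] by (simp add: measure_eq_0_null_sets)
  assume g: "integrable M g"
  have "(\<lambda>j. LINT x:unreturned A j|M. g x) \<longlonglongrightarrow> (LINT x:(\<Inter>j. unreturned A j)|M. g x)"
    using A g by (intro set_integral_cont_down decseq_unreturned set_integrable_of_integrable) auto
  also have "(LINT x:(\<Inter>j. unreturned A j)|M. g x) = 0"
    unfolding set_lebesgue_integral_def
  proof (rule integral_eq_zero_AE)
    show "AE x in M. indicat_real (\<Inter>j. unreturned A j) x *\<^sub>R g x = 0"
      using AE_not_in[OF never_return_null[OF c A(1)]]
      by eventually_elim (simp only: indicator_simps scaleR_zero_left not_False_eq_True)
  qed
  finally show "(\<lambda>j. LINT x:unreturned A j|M. g x) \<longlonglongrightarrow> 0" .
qed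

text \<open>The limit 1 is the total mass of \<open>f\<close>. Replacing the integral of the iterate
  of index \<open>k\<close> over \<open>unreturned A j\<close> by \<open>q j / b k\<close> is
  legitimate because the bound valid almost everywhere on \<open>A\<close>, integrated over a
  subset, is scaled by the measure of that subset.\<close>

lemma uniformly_returning_renewal:
  assumes c: "conservative_map M T" and e: "ergodic_map M T"
    and ret: "uniformly_returning_via M T A f b"
  shows "(\<lambda>n. \<Sum>k\<le>n. measure M (unreturned A (n - k)) / b k) \<longlonglongrightarrow> 1"
proof -
  have A: "A \<in> sets M" "0 < emeasure M A" "emeasure M A < \<infinity>" and b: "\<And>n. 0 < b n"
    and fd: "f \<in> ac_prob_densities M"
    and lim: "(\<lambda>n. esssup (restrict_space M A) (\<lambda>x. ereal \<bar>b n * (transfer_op M T ^^ n) f x - 1\<bar>))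
        \<longlonglongrightarrow> 0"
    using ret by (auto simp: uniformly_returning_via_def)
  have fm [measurable]: "f \<in> borel_measurable M" and f0: "AE x in M. 0 \<le> f x"
    and "prob_space (density M (\<lambda>x. ennreal (f x)))"
    using fd by (auto simp: ac_prob_densities_def ac_prob_measures_def)
  then have "(\<integral>\<^sup>+x. ennreal (f x) \<partial>M) = 1"
    using prob_space.emeasure_space_1 by (fastforce simp: emeasure_density cong: nn_integral_cong)
  then have "has_bochner_integral M f 1"
    using f0 by (intro has_bochner_integral_nn_integral) auto
  then have f: "integrable M f" "integral\<^sup>L M f = 1" by (auto simp: has_bochner_integral_iff)
  define g where "g n = (transfer_op M T ^^ n) f" for n
  have g: "integrable M (g n)" for n using transfer_op_pow[OF f(1)] by (simp add: g_def)
  define q where "q j = measure M (unreturned A j)" for j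
  have "(\<lambda>n. \<Sum>k\<le>n. q (n - k) / b k) \<longlonglongrightarrow> 1"
  proof (rule perturbed_convolution_tendsto[where v = "\<lambda>k j. LINT x:unreturned A j|M. g k x"])
    show "q \<longlonglongrightarrow> 0" unfolding q_def by (rule unreturned_tendsto_0(1)[OF c A(1,3)])
    show "(\<lambda>j. LINT x:unreturned A j|M. g k x) \<longlonglongrightarrow> 0" for k
      by (rule unreturned_tendsto_0(2)[OF c A(1,3) g])
    show "(\<lambda>n. \<Sum>k\<le>n. LINT x:unreturned A (n - k)|M. g k x) \<longlonglongrightarrow> 1"
      using last_visit_integral_tendsto[OF c e A(1,2) f(1)] f(2) by (simp add: g_def)
    fix \<epsilon> :: real assume \<epsilon>: "0 < \<epsilon>"
    have "\<forall>\<^sub>F n in sequentially.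
        esssup (restrict_space M A) (\<lambda>x. ereal \<bar>b n * g n x - 1\<bar>) < ereal \<epsilon>"
      using lim \<epsilon> by (intro order_tendstoD(2)) (auto simp: g_def)
    then show "\<forall>\<^sub>F k in sequentially. \<forall>j.
        \<bar>b k * (LINT x:unreturned A j|M. g k x) - q j\<bar> \<le> \<epsilon> * q j"
    proof (eventually_elim, intro allI)
      fix n j
      \<comment> \<open>Only \<open>n\<close> is restricted by the bound; it holds on all of
        \<open>A\<close>, and so the estimate below is uniform in \<open>j\<close>.\<close>
      assume ess: "esssup (restrict_space M A) (\<lambda>x. ereal \<bar>b n * g n x - 1\<bar>) < ereal \<epsilon>"
      have "AE x in restrict_space M A. ereal \<bar>b n * g n x - 1\<bar> \<le> ereal \<epsilon>"
        using esssup_AE[of "\<lambda>x. ereal \<bar>b n * g n x - 1\<bar>" "restrict_space M A"]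
        by eventually_elim (use ess in order)
      then have bound: "AE x in M. x \<in> A \<longrightarrow> \<bar>b n * g n x - 1\<bar> \<le> \<epsilon>"
        using A by (simp add: AE_restrict_space_iff)
      let ?C = "unreturned A j"
      have C: "?C \<in> sets M" "?C \<subseteq> A" using A by (auto simp: unreturned_def)
      have finC: "emeasure M ?C < \<infinity>" using emeasure_mono[OF C(2) A(1)] A(3) by (rule le_less_trans)
      have i1: "integrable M (\<lambda>x. indicator ?C x *\<^sub>R g n x)" using C g by (intro integrable_mult_indicator)
      have i2: "integrable M (indicator ?C :: 'a \<Rightarrow> real)"
        using C finC by (intro integrable_real_indicator)
      have i3: "integrable M (\<lambda>x. b n * (indicator ?C x *\<^sub>R g n x) - indicator ?C x)"
        by (intro Bochner_Integration.integrable_diff integrable_mult_right i1 i2)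
      have "b n * (LINT x:?C|M. g n x) - q j
          = (\<integral>x. b n * (indicator ?C x *\<^sub>R g n x) - indicator ?C x \<partial>M)"
        unfolding set_lebesgue_integral_def q_def
        using i1 i2 C finC by (subst Bochner_Integration.integral_diff) (auto simp: Int_absorb2 sets.sets_into_space)
      also have "\<bar>\<dots>\<bar> \<le> (\<integral>x. \<bar>b n * (indicator ?C x *\<^sub>R g n x) - indicator ?C x\<bar> \<partial>M)"
        by (rule integral_abs_bound)
      also have "\<dots> \<le> (\<integral>x. \<epsilon> * indicator ?C x \<partial>M)"
      proof (rule integral_mono_AE)
        show "AE x in M. \<bar>b n * (indicator ?C x *\<^sub>R g n x) - indicator ?C x\<bar> \<le> \<epsilon> * indicator ?C x"
          using bound by eventually_elim (use C \<epsilon> in \<open>auto simp: indicator_def\<close>)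
      qed (use i2 i3 in auto)
      also have "\<dots> = \<epsilon> * q j" using C by (simp add: q_def Int_absorb2 sets.sets_into_space)
      finally show "\<bar>b n * (LINT x:?C|M. g n x) - q j\<bar> \<le> \<epsilon> * q j" .
    qed
  qed (use b in \<open>auto simp: q_def\<close>)
  then show ?thesis by (simp add: q_def)
qed

end

theorem proposition1p2:
  fixes M :: "'a measure" and T :: "'a \<Rightarrow> 'a" and A :: "'a set"
    and f :: "'a \<Rightarrow> real" and b :: "nat \<Rightarrow> real" and \<beta> :: real
  assumes "sigma_finite_measure M" and "emeasure M (space M) = \<infinity>"
    and "measure_preserving M T" and "conservative_map M T" and "ergodic_map M T"
    and "uniformly_returning_via M T A f b"
    and "0 \<le> \<beta>" and "\<beta> < 1"
  shows "(regularly_varying_seq b \<beta> \<longleftrightarrow> regularly_varying_seq (wandering_rate M T A) \<beta>) \<and>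
    (regularly_varying_seq b \<beta> \<longrightarrow>
       b \<sim>[sequentially] (\<lambda>n. wandering_rate M T A n * Gamma (1 - \<beta>) * Gamma (1 + \<beta>)))"
proof -
  interpret sigma_finite_measure M by fact
  interpret measure_preserving_system M T by unfold_locales fact
  have A: "A \<in> sets M" "0 < emeasure M A" "emeasure M A < \<infinity>"
    and b: "\<And>n. 0 < b n" "incseq b"
    using assms(6) by (auto simp: uniformly_returning_via_def)
  define q where "q j = measure M (unreturned A j)" for j
  have W: "wandering_rate M T A = (\<lambda>n. \<Sum>j\<le>n. q j)"
    using wandering_rate_conv_sum[OF A(1,3)] by (auto simp: q_def)
  have q: "0 \<le> q j" "q j \<le> measure M A" for j
    unfolding q_def using A by (auto simp: unreturned_def fmeasurable_def intro!: measure_mono_fmeasurable)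
  \<comment> \<open>With no steps to wait nothing is removed, so \<open>q 0\<close> is the measure
    of \<open>A\<close>; this makes every \<open>W n\<close> positive.\<close>
  have q0: "0 < q 0"
    using A by (auto simp: q_def unreturned_def measure_def enn2real_positive_iff)
  note renewal = uniformly_returning_renewal[OF assms(4,5,6), folded q_def]
  note rv = renewal_regular_variation[OF b(2,1) q q0 renewal assms(7,8), folded W]
  have "b \<sim>[sequentially] (\<lambda>n. wandering_rate M T A n * Gamma (1 - \<beta>) * Gamma (1 + \<beta>))"
    if "regularly_varying_seq b \<beta>"
  \<comment> \<open>The available limit is that of \<open>W / b\<close>, so the equivalence is
    proved with the two sides exchanged.\<close>
  proof (rule asymp_equiv_symI, rule asymp_equivI')
    have G: "0 < Gamma (1 + \<beta>)" "0 < Gamma (1 - \<beta>)" using assms(7,8) by (auto intro!: Gamma_real_pos)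
    have "(\<lambda>n. wandering_rate M T A n / b n * (Gamma (1 - \<beta>) * Gamma (1 + \<beta>))) \<longlonglongrightarrow>
        1 / (Gamma (1 + \<beta>) * Gamma (1 - \<beta>)) * (Gamma (1 - \<beta>) * Gamma (1 + \<beta>))"
      unfolding W by (intro tendsto_mult_right rv(3) disjI1 that)
    then show "(\<lambda>n. wandering_rate M T A n * Gamma (1 - \<beta>) * Gamma (1 + \<beta>) / b n) \<longlonglongrightarrow> 1"
      using G by (simp add: mult.assoc)
  qed
  with rv(1,2) show ?thesis by blast
qed

end
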